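(* Let $c>0$, $c_1>0$, $\alpha>0$. Suppose $f:[0,1]^2\to\mathbb{R}$ is a $(c,\alpha)$-mixed Hölder function that is sampled at $l$ points $X_1,\dots,X_l$ chosen (independently and) uniformly at random from the unit square $[0,1]^2$, and let the locations $X_1,\dots,X_l$ and the function values $f(X_1),\dots,f(X_l)$ be given. Let $n$ be a positive integer. If $l\ge c_1 n\log^2 n$, then one can compute from this data an approximation $\tilde f:[0,1]^2\to\mathbb{R}$ of $f$ such that $$\|f-\tilde f\|_{L^2([0,1]^2)}=\mathcal{O}\big(n^{-\alpha}\log^{3/2}n\big)$$ with probability at least $1-n^{2-c_1}$, where the implicit constant depends only on $c$ and $c_1$.
   Context: A function $f:[0,1]^2\to\mathbb{R}$ is $(c,\alpha)$-mixed Hölder if for all $x,x',y,y'\in[0,1]$: $|f(x',y)-f(x,y)|\le c|x'-x|^\alpha$, $|f(x,y')-f(x,y)|\le c|y'-y|^\alpha$, and $|f(x',y')-f(x,y')-f(x',y)+f(x,y)|\le c(|x'-x||y'-y|)^\alpha$. "One can compute from this data" means: $\tilde f$ is the output of a reconstruction map whose only information about the particular function $f$ is the data $X_1,\dots,X_l$, $f(X_1),\dots,f(X_l)$ (the map may depend on the parameters $n,l,c,\alpha,c_1$ but not on $f$). The function $f$ is fixed and the probability is over the random choice of $X_1,\dots,X_l$. $\log$ is the natural logarithm, and $\log^p n=(\log n)^p$. *)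

theory Defs
  imports "HOL-Probability.Probability"
begin

definition mixed_holder :: "real \<Rightarrow> real \<Rightarrow> (real \<times> real \<Rightarrow> real) \<Rightarrow> bool" where
  "mixed_holder c \<alpha> f \<longleftrightarrow>
    (\<forall>x\<in>{0..1}. \<forall>x'\<in>{0..1}. \<forall>y\<in>{0..1}. \<forall>y'\<in>{0..1}.
      \<bar>f (x', y) - f (x, y)\<bar> \<le> c * \<bar>x' - x\<bar> powr \<alpha> \<and>
      \<bar>f (x, y') - f (x, y)\<bar> \<le> c * \<bar>y' - y\<bar> powr \<alpha> \<and>
      \<bar>f (x', y') - f (x, y') - f (x', y) + f (x, y)\<bar> \<le> c * (\<bar>x' - x\<bar> * \<bar>y' - y\<bar>) powr \<alpha>)"

(* The space of this measure is the square itself, not the plane: functions on the square are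
   represented by total functions with arbitrary values elsewhere, and those values must not
   influence the measurability of any event below. *)
definition unit_square :: "(real \<times> real) measure" where
  "unit_square = restrict_space lborel ({0..1} \<times> {0..1})"

lemma prob_space_unit_square: "prob_space unit_square"
proof
  have "emeasure (lborel :: (real \<times> real) measure) ({0..1} \<times> {0..1}) = 1"
    by (simp add: lborel_prod[symmetric] lborel.emeasure_pair_measure_Times)
  then show "emeasure unit_square (space unit_square) = 1"
    by (simp add: unit_square_def space_restrict_space emeasure_restrict_space borel_closed closed_Times)
qed

(* The joint law of l independent uniform points X 0, ..., X (l - 1) of the square. *)
definition uniform_samples :: "nat \<Rightarrow> (nat \<Rightarrow> real \<times> real) measure" where
  "uniform_samples l = (\<Pi>\<^sub>M i\<in>{..<l}. unit_square)"

(* The restriction to {..<l} makes the value undefined at all other indices, so that nothing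
   but f (X 0), ..., f (X (l - 1)) is recorded. *)
definition sample_values ::
  "nat \<Rightarrow> (real \<times> real \<Rightarrow> real) \<Rightarrow> (nat \<Rightarrow> real \<times> real) \<Rightarrow> nat \<Rightarrow> real" where
  "sample_values l f X = (\<lambda>i\<in>{..<l}. f (X i))"

definition square_integrable :: "(real \<times> real \<Rightarrow> real) \<Rightarrow> bool" where
  "square_integrable g \<longleftrightarrow>
    g \<in> borel_measurable unit_square \<and> integrable unit_square (\<lambda>p. (g p)\<^sup>2)"

(* Meaningful only for square integrable g: the integral is 0 for non-integrable functions. *)
definition L2_norm :: "(real \<times> real \<Rightarrow> real) \<Rightarrow> real" where
  "L2_norm g = sqrt (\<integral>p. (g p)\<^sup>2 \<partial>unit_square)"

end

theory Submission
  imports Defs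
begin

text \<open>
  Let \<open>V\<close> be the span of the products \<open>w\<^sub>i(x) w\<^sub>j(y)\<close> of Walsh functions over a hyperbolic cross of
  order \<open>2 ^ m\<close> comparable to \<open>n\<close>; its dimension \<open>D\<close> is \<open>O(n log n)\<close>. A telescoping sum of mixed
  differences approximates a mixed Hoelder function by an element of \<open>V\<close>, uniformly up to
  \<open>\<epsilon> = O(n powr (- \<alpha>) log n)\<close>.

  A Kaczmarz step at a random point projects coefficient vectors onto the complement of the vector of
  basis values there, whose squared length is \<open>D\<close>; in mean it shrinks the squared Hilbert--Schmidt
  norm of the residual operator by the factor \<open>1 - 1 / D\<close>. By Markov's inequality, about
  \<open>N = c1 D log n\<close> steps bring it below \<open>1 / 4\<close>, except with probability \<open>n powr (2 - c1)\<close>. On this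
  event an element of \<open>V\<close> whose samples are at most \<open>\<epsilon>\<close> has norm at most \<open>2 \<epsilon> sqrt (N / D)\<close>, because
  each step adds at most \<open>\<epsilon>\<^sup>2 / D\<close> to the squared norm of the Kaczmarz iterate; this is the extra
  factor \<open>sqrt (log n)\<close>. Hence two mixed Hoelder functions with the same samples are close, and any
  mixed Hoelder interpolant of the data is a good reconstruction.

  The constant must not depend on \<open>\<alpha>\<close>, so \<open>\<alpha> > 1\<close> is treated separately: then the function is constant.
\<close>

section \<open>Walsh functions\<close>

text \<open>Sending 1 to 1 rather than to 0 makes the digit expansion work on the whole closed interval.\<close>

definition doubling :: "real \<Rightarrow> real" where
  "doubling x = (if x < 1/2 then 2 * x else 2 * x - 1)"

text \<open>On [0, 1] this is the left end of the dyadic interval of order \<open>k\<close>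
  containing \<open>x\<close>, with the point 1 counted in the last interval. The recursion strips
  the leading binary digit, as that of \<open>walsh\<close> does, so one induction serves
  both.\<close>

primrec dyadic_floor :: "nat \<Rightarrow> real \<Rightarrow> real" where
  "dyadic_floor 0 x = 0"
| "dyadic_floor (Suc k) x = (dyadic_floor k (doubling x) + of_bool (x \<ge> 1/2)) / 2"

text \<open>Walsh functions in Paley's order: the bits of \<open>i\<close>, lowest first, select
  which binary digits of \<open>x\<close>, leading one first, contribute a sign.\<close>

fun walsh :: "nat \<Rightarrow> real \<Rightarrow> real" where
  "walsh i x = (if i = 0 then 1 else
     (if odd i \<and> x \<ge> 1/2 then - 1 else 1) * walsh (i div 2) (doubling x))"

declare walsh.simps [simp del]

lemma walsh_0 [simp]: "walsh 0 x = 1"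
  by (simp add: walsh.simps)

lemma walsh_rec:
  "walsh i x = (if odd i \<and> x \<ge> 1/2 then - 1 else 1) * walsh (i div 2) (doubling x)"
  by (cases "i = 0") (simp_all add: walsh.simps[of i])

lemma walsh_square [simp]: "(walsh i x)\<^sup>2 = 1"
proof (induction i x rule: walsh.induct)
  case (1 i x)
  then show ?case
    by (cases "i = 0") (simp_all add: walsh_rec[of i] power_mult_distrib)
qed

lemma borel_measurable_doubling [measurable]: "doubling \<in> borel_measurable borel"
  unfolding doubling_def[abs_def] by measurable

lemma borel_measurable_walsh [measurable]: "walsh i \<in> borel_measurable borel"
proof (induction i rule: less_induct)
  case (less i)
  show ?case
  proof (cases "i = 0")
    case False
    then have [measurable]: "walsh (i div 2) \<in> borel_measurable borel"
      by (intro less) simp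
    show ?thesis
      by (subst walsh_rec[abs_def]) measurable
  qed (simp add: walsh.simps[abs_def])
qed

lemma dyadic_floor_bounds: "0 \<le> dyadic_floor k x" "dyadic_floor k x < 1"
proof -
  have "0 \<le> dyadic_floor k x \<and> dyadic_floor k x < 1"
  proof (induction k arbitrary: x)
    case (Suc k)
    from Suc[of "doubling x"] show ?case
      by (auto simp: field_simps of_bool_def)
  qed auto
  then show "0 \<le> dyadic_floor k x" "dyadic_floor k x < 1"
    by auto
qed

lemma dyadic_floor_approx:
  assumes "x \<in> {0..1}"
  shows "\<bar>x - dyadic_floor k x\<bar> \<le> 1 / 2 ^ k"
  using assms
proof (induction k arbitrary: x)
  case (Suc k)
  have "doubling x \<in> {0..1}"
    using Suc.prems by (auto simp: doubling_def)
  from Suc.IH[OF this] have "\<bar>doubling x - dyadic_floor k (doubling x)\<bar> \<le> 1 / 2 ^ k" .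
  moreover have "x - dyadic_floor (Suc k) x = (doubling x - dyadic_floor k (doubling x)) / 2"
    by (auto simp: doubling_def field_simps)
  ultimately show ?case
    by (simp only: abs_divide) simp
qed auto

lemma dyadic_floor_refine: "\<bar>dyadic_floor (Suc k) x - dyadic_floor k x\<bar> \<le> 1 / 2 ^ Suc k"
proof (induction k arbitrary: x)
  case (Suc k)
  have "dyadic_floor (Suc (Suc k)) x - dyadic_floor (Suc k) x
      = (dyadic_floor (Suc k) (doubling x) - dyadic_floor k (doubling x)) / 2"
    by (auto simp: field_simps)
  with Suc[of "doubling x"] show ?case
    by (simp only: abs_divide) simp
qed auto

lemma sum_lessThan_double:
  fixes f :: "nat \<Rightarrow> 'a::comm_monoid_add"
  shows "(\<Sum>i<2 * n. f i) = (\<Sum>i<n. f (2 * i) + f (2 * i + 1))"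
  by (induction n) (simp_all add: ac_simps)

text \<open>The indices \<open>2 * i\<close> and \<open>2 * i + 1\<close> differ only in whether the
  leading digit contributes its sign. Pairing them takes out the factor \<open>1 + s\<close>, where
  \<open>s\<close> is the product of the leading signs of \<open>x\<close> and \<open>y\<close>: it
  is 2 if these digits agree and 0 otherwise.\<close>

lemma sum_walsh_kernel:
  "(\<Sum>i<2 ^ k. walsh i x * walsh i y) = (if dyadic_floor k x = dyadic_floor k y then 2 ^ k else 0)"
proof (induction k arbitrary: x y)
  case (Suc k)
  define s where "s = (if (x \<ge> 1/2) = (y \<ge> 1/2) then 1 else - 1 :: real)"
  have "(\<Sum>i<2 ^ Suc k. walsh i x * walsh i y)
      = (\<Sum>i<2 ^ k. (1 + s) * (walsh i (doubling x) * walsh i (doubling y)))"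
    unfolding power_Suc sum_lessThan_double
    by (intro sum.cong refl, subst (1 2 3 4) walsh_rec) (auto simp: s_def)
  \<comment> \<open>As \<open>dyadic_floor k\<close> takes values in [0, 1), its successor is below
    1/2 exactly when the leading digit is 0; hence equal values at \<open>Suc k\<close> force equal
    leading digits.\<close>
  also have "\<dots> = (1 + s) * (if dyadic_floor k (doubling x) = dyadic_floor k (doubling y) then 2 ^ k else 0)"
    by (simp add: sum_distrib_left[symmetric] Suc)
  also have "\<dots> = (if dyadic_floor (Suc k) x = dyadic_floor (Suc k) y then 2 ^ Suc k else 0)"
    using dyadic_floor_bounds[of k "doubling x"] dyadic_floor_bounds[of k "doubling y"]
    by (auto simp: s_def field_simps)
  finally show ?case .
qed simp

lemma finite_range_dyadic_floor: "finite (range (dyadic_floor k))"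
proof (induction k)
  case (Suc k)
  have "range (dyadic_floor (Suc k)) \<subseteq> (\<lambda>(u, b). (u + of_bool b) / 2) ` (range (dyadic_floor k) \<times> UNIV)"
    by auto
  then show ?case
    by (rule finite_subset) (intro finite_imageI finite_SigmaI Suc finite)
qed simp

text \<open>Divided by \<open>2 ^ k\<close>, the kernel of \<open>sum_walsh_kernel\<close> is the
  indicator of a dyadic interval. A step function is thus a combination of kernels, each centred at
  one point \<open>\<rho> u\<close> of its interval.\<close>

lemma walsh_expansion:
  fixes g :: "real \<Rightarrow> real"
  shows "\<exists>a. \<forall>x. g (dyadic_floor k x) = (\<Sum>i<2 ^ k. a i * walsh i x)"
proof -
  let ?U = "range (dyadic_floor k)"
  define \<rho> where "\<rho> = inv (dyadic_floor k)"
  have \<rho>: "dyadic_floor k (\<rho> u) = u" if "u \<in> ?U" for u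
    using that by (simp add: \<rho>_def f_inv_into_f)
  have "g (dyadic_floor k x) = (\<Sum>i<2 ^ k. (\<Sum>u\<in>?U. g u * walsh i (\<rho> u) / 2 ^ k) * walsh i x)" for x
  proof -
    have "g (dyadic_floor k x) = (\<Sum>u\<in>?U. if u = dyadic_floor k x then g u else 0)"
      by (simp add: finite_range_dyadic_floor)
    also have "\<dots> = (\<Sum>u\<in>?U. g u / 2 ^ k * (\<Sum>i<2 ^ k. walsh i (\<rho> u) * walsh i x))"
      by (intro sum.cong refl) (auto simp: sum_walsh_kernel \<rho>)
    also have "\<dots> = (\<Sum>i<2 ^ k. (\<Sum>u\<in>?U. g u * walsh i (\<rho> u) / 2 ^ k) * walsh i x)"
      by (simp add: sum_distrib_left sum_distrib_right mult_ac) (rule sum.swap)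
    finally show ?thesis .
  qed
  then show ?thesis
    by (intro exI[of _ "\<lambda>i. \<Sum>u\<in>?U. g u * walsh i (\<rho> u) / 2 ^ k"]) blast
qed

text \<open>One variable at a time: expand in \<open>x\<close> with the second argument frozen, then
  expand the coefficients as functions of that argument.\<close>

lemma walsh_expansion2:
  fixes g :: "real \<Rightarrow> real \<Rightarrow> real"
  shows "\<exists>a. \<forall>x y. g (dyadic_floor k x) (dyadic_floor k' y)
    = (\<Sum>(i, j)\<in>{..<2 ^ k} \<times> {..<2 ^ k'}. a (i, j) * (walsh i x * walsh j y))"
proof -
  have "\<forall>v. \<exists>a. \<forall>x. g (dyadic_floor k x) v = (\<Sum>i<2 ^ k. a i * walsh i x)"
    using walsh_expansion[of "\<lambda>u. g u v" k for v] by blast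
  then obtain a where a: "g (dyadic_floor k x) v = (\<Sum>i<2 ^ k. a v i * walsh i x)" for v x
    by metis
  have "\<forall>i. \<exists>b. \<forall>y. a (dyadic_floor k' y) i = (\<Sum>j<2 ^ k'. b j * walsh j y)"
    using walsh_expansion[of "\<lambda>v. a v i" k' for i] by blast
  then obtain b where b: "a (dyadic_floor k' y) i = (\<Sum>j<2 ^ k'. b i j * walsh j y)" for i y
    by metis
  have "g (dyadic_floor k x) (dyadic_floor k' y)
      = (\<Sum>(i, j)\<in>{..<2 ^ k} \<times> {..<2 ^ k'}. b i j * (walsh i x * walsh j y))" for x y
    by (simp add: a b sum_distrib_left sum_distrib_right mult_ac sum.cartesian_product[symmetric])
  then show ?thesis
    by (intro exI[of _ "\<lambda>(i, j). b i j"]) simp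
qed

section \<open>Orthonormality of the Walsh functions\<close>

definition unit_mean :: "(real \<Rightarrow> real) \<Rightarrow> real" where
  "unit_mean f = (\<integral>x. indicator {0..<1} x * f x \<partial>lborel)"

lemma integrable_indicator_unit:
  fixes f :: "real \<Rightarrow> real"
  assumes [measurable]: "f \<in> borel_measurable borel" and "\<And>x. \<bar>f x\<bar> \<le> 1"
    and "A \<subseteq> {0..1}" and [measurable]: "A \<in> sets borel"
  shows "integrable lborel (\<lambda>x. indicator A x * f x)"
proof (rule Bochner_Integration.integrable_bound)
  show "integrable lborel (indicator {0..1::real} :: real \<Rightarrow> real)"
    by simp
  show "AE x in lborel. norm (indicator A x * f x) \<le> norm (indicator {0..1} x :: real)"
    using assms by (intro always_eventually) (auto simp: indicator_def)
qed measurable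

text \<open>With the half-open interval the two halves are exactly its images under
  \<open>u / 2\<close> and \<open>(1 + u) / 2\<close>, and \<open>doubling\<close> returns
  \<open>u\<close> at these points. On the closed interval this would fail at \<open>u = 1\<close>
  in the first half.\<close>

lemma unit_mean_halves:
  assumes [measurable]: "f \<in> borel_measurable borel" and "\<And>x. \<bar>f x\<bar> \<le> 1"
  shows "unit_mean f = (unit_mean (\<lambda>u. f (u / 2)) + unit_mean (\<lambda>u. f ((1 + u) / 2))) / 2"
proof -
  have "unit_mean f = (\<integral>x. indicator {0..<1/2} x * f x + indicator {1/2..<1} x * f x \<partial>lborel)"
    unfolding unit_mean_def by (intro Bochner_Integration.integral_cong) (auto simp: indicator_def)
  also have "\<dots> = (\<integral>x. indicator {0..<1/2} x * f x \<partial>lborel) + (\<integral>x. indicator {1/2..<1} x * f x \<partial>lborel)"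
    using assms by (intro Bochner_Integration.integral_add integrable_indicator_unit) auto
  also have "(\<integral>x. indicator {0..<1/2} x * f x \<partial>lborel) = unit_mean (\<lambda>u. f (u / 2)) / 2"
    unfolding unit_mean_def by (subst lborel_integral_real_affine[where c = "1/2" and t = 0])
      (auto simp: indicator_def intro!: Bochner_Integration.integral_cong)
  also have "(\<integral>x. indicator {1/2..<1} x * f x \<partial>lborel) = unit_mean (\<lambda>u. f ((1 + u) / 2)) / 2"
    unfolding unit_mean_def by (subst lborel_integral_real_affine[where c = "1/2" and t = "1/2"])
      (auto simp: indicator_def add_divide_distrib intro!: Bochner_Integration.integral_cong)
  finally show ?thesis
    by simp
qed

lemma abs_walsh [simp]: "\<bar>walsh i x\<bar> = 1"
  using walsh_square[of i x] unfolding power2_eq_1_iff by auto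

lemma doubling_half:
  assumes "0 \<le> u" "u < 1"
  shows "doubling (u / 2) = u" "doubling ((1 + u) / 2) = u" "\<not> 1 \<le> u" "1/2 \<le> (1 + u) / 2"
  using assms by (auto simp: doubling_def field_simps)

text \<open>Averaging over the two halves strips the lowest bits of \<open>i\<close> and
  \<open>j\<close>. The signs of the leading digit leave the factor \<open>(1 + 1) / 2\<close> if
  the parities agree and \<open>(1 - 1) / 2\<close> if not.\<close>

lemma unit_mean_walsh: "unit_mean (\<lambda>x. walsh i x * walsh j x) = of_bool (i = j)"
proof (induction "i + j" arbitrary: i j rule: less_induct)
  case less
  show ?case
  proof (cases "i + j = 0")
    case False
    let ?p = "unit_mean (\<lambda>x. walsh (i div 2) x * walsh (j div 2) x)"
    have p: "?p = of_bool (i div 2 = j div 2)"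
      using False by (intro less) auto
    have "unit_mean (\<lambda>u. walsh i (u / 2) * walsh j (u / 2)) = ?p"
      unfolding unit_mean_def walsh_rec[of i] walsh_rec[of j]
      by (intro Bochner_Integration.integral_cong) (auto simp: indicator_def doubling_half simp del: le_divide_eq_numeral1)
    moreover have "unit_mean (\<lambda>u. walsh i ((1 + u) / 2) * walsh j ((1 + u) / 2))
        = unit_mean (\<lambda>u. (if even i = even j then 1 else - 1) * (walsh (i div 2) u * walsh (j div 2) u))"
      unfolding unit_mean_def walsh_rec[of i] walsh_rec[of j]
      by (intro Bochner_Integration.integral_cong) (auto simp: indicator_def doubling_half simp del: le_divide_eq_numeral1)
    moreover have "\<dots> = (if even i = even j then 1 else - 1) * ?p"
      by (auto simp: unit_mean_def)
    ultimately have "unit_mean (\<lambda>x. walsh i x * walsh j x)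
        = (1 + (if even i = even j then 1 else - 1)) / 2 * ?p"
      by (subst unit_mean_halves) (auto simp: abs_mult)
    also have "\<dots> = of_bool (i = j)"
    proof -
      have "i = j \<longleftrightarrow> i div 2 = j div 2 \<and> (even i = even j)"
        by (metis div_mult_mod_eq mod2_eq_if)
      then show ?thesis
        unfolding p by auto
    qed
    finally show ?thesis .
  qed (simp add: unit_mean_def)
qed

lemma sets_unit_square: "sets unit_square = sets (restrict_space borel ({0..1} \<times> {0..1}))"
  by (simp add: unit_square_def sets_restrict_space)

lemma space_unit_square [simp]: "space unit_square = {0..1} \<times> {0..1}"
  by (simp add: unit_square_def space_restrict_space)

lemma integral_unit_square_product:
  assumes [measurable]: "f \<in> borel_measurable borel" "g \<in> borel_measurable borel"
    and "\<And>x. \<bar>f x\<bar> \<le> 1" "\<And>x. \<bar>g x\<bar> \<le> 1"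
  shows "(\<integral>p. f (fst p) * g (snd p) \<partial>unit_square) = unit_mean f * unit_mean g"
proof -
  define F where "F = (\<lambda>x. indicator {0..1} x * f x)"
  define G where "G = (\<lambda>x. indicator {0..1} x * g x)"
  have int: "integrable lborel F" "integrable lborel G"
    unfolding F_def G_def using assms by (auto intro!: integrable_indicator_unit)
  \<comment> \<open>The square is closed while \<open>unit_mean\<close> uses a half-open interval;
    the endpoint 1 is a null set.\<close>
  have eq: "integral\<^sup>L lborel F = unit_mean f" "integral\<^sup>L lborel G = unit_mean g"
    unfolding F_def G_def unit_mean_def
    by (auto intro!: integral_cong_AE AE_I[of _ _ "{1}"] simp: indicator_def of_bool_def split: if_splits)
  have int2: "integrable (lborel \<Otimes>\<^sub>M lborel) (\<lambda>p. F (fst p) * G (snd p))"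
    using int by (intro lborel_pair.Fubini_integrable) (auto simp: abs_mult)
  have "(\<integral>p. f (fst p) * g (snd p) \<partial>unit_square)
      = (\<integral>p. F (fst p) * G (snd p) \<partial>(lborel \<Otimes>\<^sub>M lborel))"
    unfolding unit_square_def lborel_prod F_def G_def
    by (subst integral_restrict_space)
      (auto simp: indicator_def closed_Times intro!: Bochner_Integration.integral_cong)
  also have "\<dots> = unit_mean f * unit_mean g"
    by (subst lborel_pair.integral_fst'[OF int2, symmetric]) (simp add: eq)
  finally show ?thesis .
qed

section \<open>Approximation from the hyperbolic cross\<close>

text \<open>A staircase below the hyperbola \<open>i * j = 2 ^ m\<close>. Its rectangle number
  \<open>k\<close> carries the functions of the leading \<open>k\<close> digits of \<open>x\<close>
  and \<open>m - k\<close> digits of \<open>y\<close>.\<close>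

definition hyperbolic_cross :: "nat \<Rightarrow> (nat \<times> nat) set" where
  "hyperbolic_cross m = (\<Union>k\<le>m. {..<2 ^ k} \<times> {..<2 ^ (m - k)})"

lemma finite_hyperbolic_cross: "finite (hyperbolic_cross m)"
  by (simp add: hyperbolic_cross_def)

lemma card_hyperbolic_cross_le: "card (hyperbolic_cross m) \<le> Suc m * 2 ^ m"
proof -
  have "card (hyperbolic_cross m) \<le> (\<Sum>k\<le>m. card ({..<2 ^ k} \<times> {..<2 ^ (m - k)} :: (nat \<times> nat) set))"
    unfolding hyperbolic_cross_def by (intro card_UN_le) simp
  also have "\<dots> = (\<Sum>k\<le>m. 2 ^ m)"
    by (intro sum.cong) (simp_all add: card_cartesian_product power_add[symmetric])
  finally show ?thesis
    by simp
qed

lemma hyperbolic_cross_nonempty: "hyperbolic_cross m \<noteq> {}"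
proof -
  have "(0, 0) \<in> hyperbolic_cross m"
    by (auto simp: hyperbolic_cross_def)
  then show ?thesis
    by blast
qed

definition walsh_span :: "nat \<Rightarrow> (real \<Rightarrow> real \<Rightarrow> real) set" where
  "walsh_span m = {g. \<exists>a. \<forall>x y. g x y = (\<Sum>(i, j)\<in>hyperbolic_cross m. a (i, j) * (walsh i x * walsh j y))}"

lemma walsh_span_zero: "(\<lambda>x y. 0) \<in> walsh_span m"
  unfolding walsh_span_def by (auto intro!: exI[of _ "\<lambda>_. 0"])

lemma walsh_span_add:
  assumes "g \<in> walsh_span m" "h \<in> walsh_span m"
  shows "(\<lambda>x y. g x y + h x y) \<in> walsh_span m"
proof -
  from assms obtain a b where
    "\<forall>x y. g x y = (\<Sum>(i, j)\<in>hyperbolic_cross m. a (i, j) * (walsh i x * walsh j y))"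
    "\<forall>x y. h x y = (\<Sum>(i, j)\<in>hyperbolic_cross m. b (i, j) * (walsh i x * walsh j y))"
    by (auto simp: walsh_span_def)
  then show ?thesis
    unfolding walsh_span_def
    by (intro CollectI exI[of _ "\<lambda>p. a p + b p"])
      (simp add: sum.distrib[symmetric] case_prod_unfold algebra_simps)
qed

lemma walsh_span_diff:
  assumes "g \<in> walsh_span m" "h \<in> walsh_span m"
  shows "(\<lambda>x y. g x y - h x y) \<in> walsh_span m"
proof -
  from assms obtain a b where
    "\<forall>x y. g x y = (\<Sum>(i, j)\<in>hyperbolic_cross m. a (i, j) * (walsh i x * walsh j y))"
    "\<forall>x y. h x y = (\<Sum>(i, j)\<in>hyperbolic_cross m. b (i, j) * (walsh i x * walsh j y))"
    by (auto simp: walsh_span_def)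
  then show ?thesis
    unfolding walsh_span_def
    by (intro CollectI exI[of _ "\<lambda>p. a p - b p"])
      (simp add: sum_subtractf[symmetric] case_prod_unfold algebra_simps)
qed

lemma walsh_span_sum:
  assumes "\<And>k. k \<in> K \<Longrightarrow> g k \<in> walsh_span m"
  shows "(\<lambda>x y. \<Sum>k\<in>K. g k x y) \<in> walsh_span m"
  using assms
  by (induction K rule: infinite_finite_induct) (auto intro: walsh_span_zero walsh_span_add)

lemma walsh_span_dyadic_floor:
  assumes "k + k' \<le> m"
  shows "(\<lambda>x y. g (dyadic_floor k x) (dyadic_floor k' y)) \<in> walsh_span m"
proof -
  let ?K = "{..<2 ^ k} \<times> {..<2 ^ k'} :: (nat \<times> nat) set"
  obtain a where a: "\<And>x y. g (dyadic_floor k x) (dyadic_floor k' y)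
      = (\<Sum>(i, j)\<in>?K. a (i, j) * (walsh i x * walsh j y))"
    using walsh_expansion2[of g k k'] by blast
  have le: "(2::nat) ^ k' \<le> 2 ^ (m - k)"
    using assms by (intro power_increasing) auto
  have sub: "?K \<subseteq> hyperbolic_cross m"
    using assms unfolding hyperbolic_cross_def by (auto intro!: bexI[of _ k] less_le_trans[OF _ le])
  have "g (dyadic_floor k x) (dyadic_floor k' y)
      = (\<Sum>(i, j)\<in>hyperbolic_cross m. (if (i, j) \<in> ?K then a (i, j) else 0) * (walsh i x * walsh j y))"
    for x y
    unfolding a by (intro sum.mono_neutral_cong_left finite_hyperbolic_cross sub) (auto split: if_splits)
  then show ?thesis
    unfolding walsh_span_def
    by (intro CollectI exI[of _ "\<lambda>p. if p \<in> ?K then a p else 0"]) simp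
qed

text \<open>Telescope in \<open>x\<close> over the dyadic scales and, in the increment at scale
  \<open>k\<close>, round \<open>y\<close> to \<open>m - k\<close> digits. The error of that term is
  a mixed difference over a rectangle of area at most \<open>1 / 2 ^ m\<close>, whatever
  \<open>k\<close> is. These \<open>m + 1\<close> errors and the final rounding of \<open>x\<close>
  give the factor \<open>m + 2\<close>.\<close>

lemma mixed_holder_approximation:
  assumes mh: "mixed_holder c \<alpha> h" and "\<alpha> > 0"
  shows "\<exists>a. \<forall>x\<in>{0..1}. \<forall>y\<in>{0..1}.
    \<bar>h (x, y) - (\<Sum>(i, j)\<in>hyperbolic_cross m. a (i, j) * (walsh i x * walsh j y))\<bar>
      \<le> c * (real m + 2) * (1 / 2 ^ m) powr \<alpha>"
proof -
  define B where "B = c * (1 / 2 ^ m) powr \<alpha>"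
  let ?E = dyadic_floor
  have E: "?E k x \<in> {0..1}" for k x
    using dyadic_floor_bounds[of k x] by auto
  \<comment> \<open>The sign of \<open>c\<close> is read off from a single difference over distance
    1.\<close>
  have "\<bar>h (1, 0) - h (0, 0)\<bar> \<le> c * \<bar>1 - 0\<bar> powr \<alpha>"
    using mh unfolding mixed_holder_def by (meson atLeastAtMost_iff order_refl zero_le_one)
  then have c: "c \<ge> 0"
    by simp
  \<comment> \<open>The term at scale 0 is a value rather than an increment, so that the sum
    collapses to \<open>h (?E m x, y)\<close>. For this term the error is controlled by the
    one-variable condition in \<open>y\<close> instead of the mixed one.\<close>
  define \<delta> where "\<delta> k x y = h (?E k x, y) - (if k = 0 then 0 else h (?E (k - 1) x, y))" for k x y
  have tele: "(\<Sum>k\<le>m. \<delta> k x y) = h (?E m x, y)" for x y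
    by (induction m) (simp_all add: \<delta>_def)
  have "(\<lambda>x y. \<Sum>k\<le>m. \<delta> k x (?E (m - k) y)) \<in> walsh_span m"
  proof (rule walsh_span_sum)
    fix k assume "k \<in> {..m}"
    then have k: "k \<le> m" by simp
    have "(\<lambda>x y. if k = 0 then 0 else h (?E (k - 1) x, ?E (m - k) y)) \<in> walsh_span m"
      using k by (cases "k = 0")
        (auto simp: walsh_span_zero intro!: walsh_span_dyadic_floor[of _ _ _ "\<lambda>x y. h (x, y)"])
    with k show "(\<lambda>x y. \<delta> k x (?E (m - k) y)) \<in> walsh_span m"
      unfolding \<delta>_def
      by (intro walsh_span_diff) (auto intro!: walsh_span_dyadic_floor[of _ _ _ "\<lambda>x y. h (x, y)"])
  qed
  then obtain a where a: "\<And>x y. (\<Sum>k\<le>m. \<delta> k x (?E (m - k) y))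
      = (\<Sum>(i, j)\<in>hyperbolic_cross m. a (i, j) * (walsh i x * walsh j y))"
    by (auto simp: walsh_span_def)
  have "\<bar>h (x, y) - (\<Sum>k\<le>m. \<delta> k x (?E (m - k) y))\<bar> \<le> c * (real m + 2) * (1 / 2 ^ m) powr \<alpha>"
    if xy: "x \<in> {0..1}" "y \<in> {0..1}" for x y
  proof -
    have step: "\<bar>\<delta> k x y - \<delta> k x (?E (m - k) y)\<bar> \<le> B" if "k \<le> m" for k
    proof (cases k)
      case 0
      have "\<bar>h (0, y) - h (0, ?E m y)\<bar> \<le> c * \<bar>y - ?E m y\<bar> powr \<alpha>"
        using mh E[of m y] xy unfolding mixed_holder_def by (meson atLeastAtMost_iff order_refl zero_le_one)
      also have "\<dots> \<le> B"
        unfolding B_def using c \<open>\<alpha> > 0\<close> dyadic_floor_approx[OF xy(2), of m]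
        by (intro mult_left_mono powr_mono2) auto
      finally show ?thesis
        by (simp add: \<delta>_def 0)
    next
      case (Suc k')
      have "\<bar>h (?E k x, y) - h (?E k' x, y) - h (?E k x, ?E (m - k) y) + h (?E k' x, ?E (m - k) y)\<bar>
          \<le> c * (\<bar>?E k x - ?E k' x\<bar> * \<bar>y - ?E (m - k) y\<bar>) powr \<alpha>"
        using mh E[of k x] E[of k' x] E[of "m - k" y] xy unfolding mixed_holder_def by blast
      also have "\<dots> \<le> c * (1 / 2 ^ k * (1 / 2 ^ (m - k))) powr \<alpha>"
        using c \<open>\<alpha> > 0\<close> dyadic_floor_approx[OF xy(2), of "m - k"] dyadic_floor_refine[of k' x]
        unfolding Suc by (intro mult_left_mono powr_mono2 mult_mono) auto
      also have "\<dots> = B"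
        using that by (simp add: B_def power_add[symmetric])
      finally show ?thesis
        by (simp add: \<delta>_def Suc algebra_simps)
    qed
    have "\<bar>h (x, y) - h (?E m x, y)\<bar> \<le> c * \<bar>x - ?E m x\<bar> powr \<alpha>"
      using mh E[of m x] xy unfolding mixed_holder_def by blast
    also have "\<dots> \<le> B"
      unfolding B_def using c \<open>\<alpha> > 0\<close> dyadic_floor_approx[OF xy(1), of m]
      by (intro mult_left_mono powr_mono2) auto
    finally have first: "\<bar>h (x, y) - h (?E m x, y)\<bar> \<le> B" .
    have "\<bar>\<Sum>k\<le>m. \<delta> k x y - \<delta> k x (?E (m - k) y)\<bar> \<le> (\<Sum>k\<le>m. B)"
      by (intro order_trans[OF sum_abs] sum_mono step) simp
    then have "\<bar>h (?E m x, y) - (\<Sum>k\<le>m. \<delta> k x (?E (m - k) y))\<bar> \<le> (real m + 1) * B"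
      by (simp add: sum_subtractf tele add.commute)
    with first show ?thesis
      by (simp add: B_def algebra_simps)
  qed
  then show ?thesis
    unfolding a by (intro exI[of _ a]) blast
qed

section \<open>The randomized Kaczmarz iteration\<close>

text \<open>Unimodularity gives the vector of basis values the same squared length at every point,
  so a Kaczmarz step is always normalized by the dimension and plain sampling from \<open>M\<close>
  already contracts in mean.\<close>

locale unimodular_orthonormal_system = prob_space M for M :: "'p measure" +
  fixes J :: "'j set" and \<phi> :: "'j \<Rightarrow> 'p \<Rightarrow> real"
  assumes finite_J: "finite J" and J_nonempty: "J \<noteq> {}"
    and measurable_\<phi> [measurable]: "j \<in> J \<Longrightarrow> \<phi> j \<in> borel_measurable M"
    and unimodular: "j \<in> J \<Longrightarrow> p \<in> space M \<Longrightarrow> (\<phi> j p)\<^sup>2 = 1"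
    and orthonormal: "j \<in> J \<Longrightarrow> k \<in> J \<Longrightarrow> expectation (\<lambda>p. \<phi> j p * \<phi> k p) = of_bool (j = k)"
begin

definition dim :: real where
  "dim = real (card J)"

definition combination :: "('j \<Rightarrow> real) \<Rightarrow> 'p \<Rightarrow> real" where
  "combination x p = (\<Sum>j\<in>J. x j * \<phi> j p)"

definition norm2 :: "('j \<Rightarrow> real) \<Rightarrow> real" where
  "norm2 x = (\<Sum>j\<in>J. (x j)\<^sup>2)"

definition kaczmarz_step :: "'p \<Rightarrow> ('j \<Rightarrow> real) \<Rightarrow> 'j \<Rightarrow> real" where
  "kaczmarz_step p x = (\<lambda>j. x j - \<phi> j p * (combination x p / dim))"

text \<open>The error of the Kaczmarz iterate that starts at 0 and is driven by the samples of
  \<open>combination x\<close>. Thus \<open>x\<close> minus the residual is the iterate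
  itself.\<close>

primrec residual :: "(nat \<Rightarrow> 'p) \<Rightarrow> ('j \<Rightarrow> real) \<Rightarrow> nat \<Rightarrow> 'j \<Rightarrow> real" where
  "residual X x 0 = x"
| "residual X x (Suc i) = kaczmarz_step (X i) (residual X x i)"

text \<open>The squared Hilbert--Schmidt norm of the linear map \<open>x \<mapsto> residual X x N\<close>.\<close>

definition residual_gain :: "nat \<Rightarrow> (nat \<Rightarrow> 'p) \<Rightarrow> real" where
  "residual_gain N X = (\<Sum>k\<in>J. norm2 (residual X (\<lambda>j. of_bool (j = k)) N))"

lemma dim_ge_1: "dim \<ge> 1"
  using finite_J J_nonempty by (simp add: dim_def Suc_le_eq card_gt_0_iff)

lemma norm2_nonneg: "norm2 x \<ge> 0"
  by (simp add: norm2_def sum_nonneg)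

lemma norm2_add_row:
  assumes "p \<in> space M"
  shows "norm2 (\<lambda>j. x j + \<phi> j p * t) = norm2 x + 2 * t * combination x p + t\<^sup>2 * dim"
proof -
  have "norm2 (\<lambda>j. x j + \<phi> j p * t) = (\<Sum>j\<in>J. (x j)\<^sup>2 + 2 * t * (x j * \<phi> j p) + t\<^sup>2)"
    unfolding norm2_def using unimodular[OF _ assms]
    by (intro sum.cong refl) (simp add: power2_sum power_mult_distrib mult_ac)
  then show ?thesis
    by (simp add: norm2_def combination_def dim_def sum.distrib sum_distrib_left)
qed

lemma norm2_kaczmarz_step:
  assumes "p \<in> space M"
  shows "norm2 (kaczmarz_step p x) = norm2 x - (combination x p)\<^sup>2 / dim"
proof -
  have "kaczmarz_step p x = (\<lambda>j. x j + \<phi> j p * (- combination x p / dim))"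
    by (simp add: kaczmarz_step_def)
  then show ?thesis
    using dim_ge_1 by (simp only: norm2_add_row[OF assms]) (simp add: field_simps power2_eq_square)
qed

lemma measurable_combination [measurable]: "combination x \<in> borel_measurable M"
  unfolding combination_def by measurable

lemma combination_bounded:
  assumes "p \<in> space M"
  shows "\<bar>combination x p\<bar> \<le> (\<Sum>j\<in>J. \<bar>x j\<bar>)"
proof -
  have "\<bar>\<phi> j p\<bar> = 1" if "j \<in> J" for j
    using unimodular[OF that assms] unfolding power2_eq_1_iff by auto
  then show ?thesis
    unfolding combination_def by (intro order_trans[OF sum_abs] sum_mono) (simp add: abs_mult)
qed

lemma integrable_bounded:
  assumes "f \<in> borel_measurable M" "\<And>p. p \<in> space M \<Longrightarrow> \<bar>f p\<bar> \<le> (B::real)"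
  shows "integrable M f"
  using assms by (intro integrable_const_bound[of _ B]) auto

lemma integrable_combination_square: "integrable M (\<lambda>p. (combination x p)\<^sup>2)"
proof (rule integrable_bounded)
  show "\<bar>(combination x p)\<^sup>2\<bar> \<le> (\<Sum>j\<in>J. \<bar>x j\<bar>)\<^sup>2" if "p \<in> space M" for p
    using combination_bounded[OF that, of x] by (simp add: power2_le_iff_abs_le sum_nonneg)
qed measurable

lemma expectation_combination_square: "expectation (\<lambda>p. (combination x p)\<^sup>2) = norm2 x"
proof -
  have int: "integrable M (\<lambda>p. \<phi> j p * \<phi> k p)" if "j \<in> J" "k \<in> J" for j k
  proof (rule integrable_bounded)
    show "\<bar>\<phi> j p * \<phi> k p\<bar> \<le> 1" if p: "p \<in> space M" for p
      using unimodular[OF \<open>j \<in> J\<close> p] unimodular[OF \<open>k \<in> J\<close> p] unfolding power2_eq_1_iff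
      by (auto simp: abs_mult)
  qed (use that in measurable)
  have "(combination x p)\<^sup>2 = (\<Sum>j\<in>J. \<Sum>k\<in>J. x j * x k * (\<phi> j p * \<phi> k p))" for p
    by (simp add: combination_def power2_eq_square sum_product mult_ac)
  then have "expectation (\<lambda>p. (combination x p)\<^sup>2) = (\<Sum>j\<in>J. \<Sum>k\<in>J. x j * x k * of_bool (j = k))"
    using int by (simp add: orthonormal)
  also have "\<dots> = (\<Sum>j\<in>J. \<Sum>k\<in>J. if j = k then x j * x k else 0)"
    by (intro sum.cong) auto
  also have "\<dots> = norm2 x"
    by (simp add: norm2_def finite_J power2_eq_square)
  finally show ?thesis .
qed

text \<open>By Pythagoras a step removes \<open>(combination x p)\<^sup>2 / dim\<close>, and by
  orthonormality the mean of \<open>(combination x p)\<^sup>2\<close> is \<open>norm2 x\<close>.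
  Nonnegative integrals let this be iterated by Tonelli's theorem from measurability alone.\<close>

lemma nn_integral_kaczmarz_step:
  "(\<integral>\<^sup>+p. ennreal (norm2 (kaczmarz_step p x)) \<partial>M) = ennreal ((1 - 1 / dim) * norm2 x)"
proof -
  have "(\<integral>\<^sup>+p. ennreal (norm2 (kaczmarz_step p x)) \<partial>M)
      = (\<integral>\<^sup>+p. ennreal (norm2 x - (combination x p)\<^sup>2 / dim) \<partial>M)"
    by (intro nn_integral_cong) (simp add: norm2_kaczmarz_step)
  also have "\<dots> = ennreal (expectation (\<lambda>p. norm2 x - (combination x p)\<^sup>2 / dim))"
  proof (rule nn_integral_eq_integral)
    show "AE p in M. 0 \<le> norm2 x - (combination x p)\<^sup>2 / dim"
      by (intro AE_I2) (metis norm2_kaczmarz_step norm2_nonneg)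
  qed (use integrable_combination_square in simp)
  also have "expectation (\<lambda>p. norm2 x - (combination x p)\<^sup>2 / dim) = (1 - 1 / dim) * norm2 x"
    using integrable_combination_square
    by (simp add: expectation_combination_square prob_space algebra_simps)
  finally show ?thesis .
qed

section \<open>Contraction of the residual in mean\<close>

lemma residual_cong:
  assumes "\<And>i. i < N \<Longrightarrow> X i = Y i"
  shows "residual X x N = residual Y x N"
  using assms by (induction N) auto

lemma measurable_residual [measurable]:
  assumes "N \<le> l" "j \<in> J"
  shows "(\<lambda>X. residual X x N j) \<in> borel_measurable (\<Pi>\<^sub>M i\<in>{..<l}. M)"
  using assms
proof (induction N arbitrary: j)
  case (Suc N)
  then have [measurable]: "k \<in> J \<Longrightarrow> (\<lambda>X. residual X x N k) \<in> borel_measurable (\<Pi>\<^sub>M i\<in>{..<l}. M)" for k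
    by simp
  have [measurable]: "(\<lambda>X. X N) \<in> measurable (\<Pi>\<^sub>M i\<in>{..<l}. M) M"
    using Suc.prems by (intro measurable_component_singleton) auto
  have [measurable]: "(\<lambda>X. \<phi> k (X N)) \<in> borel_measurable (\<Pi>\<^sub>M i\<in>{..<l}. M)" if "k \<in> J" for k
    using that by measurable
  show ?case
    using Suc.prems unfolding residual.simps kaczmarz_step_def combination_def by measurable
qed simp

lemma measurable_norm2_residual [measurable]:
  "N \<le> l \<Longrightarrow> (\<lambda>X. norm2 (residual X x N)) \<in> borel_measurable (\<Pi>\<^sub>M i\<in>{..<l}. M)"
  unfolding norm2_def by measurable

lemma measurable_residual_gain [measurable]:
  "N \<le> l \<Longrightarrow> residual_gain N \<in> borel_measurable (\<Pi>\<^sub>M i\<in>{..<l}. M)"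
  unfolding residual_gain_def[abs_def] by measurable

text \<open>The induction integrates out the last sample point first. If \<open>N \<le> l\<close>,
  the residual does not see that point; if \<open>N = Suc l\<close>, it is used in exactly one step,
  independent of the earlier points.\<close>

lemma nn_integral_residual:
  assumes "N \<le> l"
  shows "(\<integral>\<^sup>+X. ennreal (norm2 (residual X x N)) \<partial>(\<Pi>\<^sub>M i\<in>{..<l}. M))
    = ennreal ((1 - 1 / dim) ^ N * norm2 x)"
  using assms
proof (induction l arbitrary: N)
  case 0
  then show ?case
    by (simp add: PiM_empty nn_integral_count_space_finite)
next
  case (Suc l)
  interpret P: product_sigma_finite "\<lambda>_::nat. M"
    by standard
  interpret L: prob_space "\<Pi>\<^sub>M i\<in>{..<l}. M"
    by (intro prob_space_PiM prob_space_axioms)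
  have "(\<integral>\<^sup>+X. ennreal (norm2 (residual X x N)) \<partial>(\<Pi>\<^sub>M i\<in>{..<Suc l}. M))
      = (\<integral>\<^sup>+X. (\<integral>\<^sup>+p. ennreal (norm2 (residual (X(l := p)) x N)) \<partial>M) \<partial>(\<Pi>\<^sub>M i\<in>{..<l}. M))"
    unfolding lessThan_Suc using Suc.prems
    by (intro P.product_nn_integral_insert) (auto simp flip: lessThan_Suc)
  also have "\<dots> = ennreal ((1 - 1 / dim) ^ N * norm2 x)"
  proof (cases "N \<le> l")
    case True
    then have "residual (X(l := p)) x N = residual X x N" for X p
      by (intro residual_cong) auto
    then show ?thesis
      using Suc.IH[OF True] by (simp add: emeasure_space_1)
  next
    case False
    then have N: "N = Suc l"
      using Suc.prems by simp
    have "residual (X(l := p)) x l = residual X x l" for X p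
      by (intro residual_cong) auto
    then have "(\<integral>\<^sup>+X. (\<integral>\<^sup>+p. ennreal (norm2 (residual (X(l := p)) x N)) \<partial>M) \<partial>(\<Pi>\<^sub>M i\<in>{..<l}. M))
        = (\<integral>\<^sup>+X. ennreal (1 - 1 / dim) * ennreal (norm2 (residual X x l)) \<partial>(\<Pi>\<^sub>M i\<in>{..<l}. M))"
      using dim_ge_1 by (simp add: N nn_integral_kaczmarz_step ennreal_mult norm2_nonneg)
    also have "\<dots> = ennreal ((1 - 1 / dim) ^ N * norm2 x)"
      using dim_ge_1 by (subst nn_integral_cmult) (simp_all add: N Suc.IH norm2_nonneg mult_ac flip: ennreal_mult)
    finally show ?thesis .
  qed
  finally show ?case .
qed

text \<open>The \<open>dim\<close> unit vectors contribute equally to the mean gain, which gives the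
  factor \<open>dim\<close>; Markov's inequality at the threshold 1/4 gives the factor 4.\<close>

lemma prob_residual_gain_less:
  assumes "N \<le> l"
  shows "measure (\<Pi>\<^sub>M i\<in>{..<l}. M) {X \<in> space (\<Pi>\<^sub>M i\<in>{..<l}. M). residual_gain N X < 1/4}
    \<ge> 1 - 4 * dim * (1 - 1 / dim) ^ N"
proof -
  interpret L: prob_space "\<Pi>\<^sub>M i\<in>{..<l}. M"
    by (intro prob_space_PiM prob_space_axioms)
  note [measurable] = measurable_residual_gain[OF assms]
  have "norm2 (\<lambda>j. of_bool (j = k)) = 1" if "k \<in> J" for k
  proof -
    have "norm2 (\<lambda>j. of_bool (j = k)) = (\<Sum>j\<in>J. if j = k then 1 else 0)"
      unfolding norm2_def by (intro sum.cong) auto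
    with that show ?thesis
      by (simp add: finite_J)
  qed
  then have "(\<integral>\<^sup>+X. ennreal (residual_gain N X) \<partial>(\<Pi>\<^sub>M i\<in>{..<l}. M)) = (\<Sum>k\<in>J. ennreal ((1 - 1 / dim) ^ N))"
    unfolding residual_gain_def using assms
    by (simp add: norm2_nonneg nn_integral_sum nn_integral_residual flip: sum_ennreal)
  also have "\<dots> = ennreal (dim * (1 - 1 / dim) ^ N)"
    using dim_ge_1 by (subst sum_ennreal) (simp_all add: dim_def)
  finally have nn: "(\<integral>\<^sup>+X. ennreal (residual_gain N X) \<partial>(\<Pi>\<^sub>M i\<in>{..<l}. M)) = ennreal (dim * (1 - 1 / dim) ^ N)" .
  have nonneg: "residual_gain N X \<ge> 0" for X
    by (simp add: residual_gain_def sum_nonneg norm2_nonneg)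
  have int: "integrable (\<Pi>\<^sub>M i\<in>{..<l}. M) (residual_gain N)"
    using nn nonneg by (intro integrableI_nonneg) auto
  have "L.expectation (residual_gain N) = dim * (1 - 1 / dim) ^ N"
    using nn nonneg dim_ge_1 by (subst integral_eq_nn_integral) auto
  moreover have "L.prob {X \<in> space (\<Pi>\<^sub>M i\<in>{..<l}. M). 1/4 \<le> residual_gain N X} \<le> L.expectation (residual_gain N) / (1/4)"
    using int nonneg by (intro integral_Markov_inequality_measure[where A = "{}"]) auto
  moreover have "{X \<in> space (\<Pi>\<^sub>M i\<in>{..<l}. M). residual_gain N X < 1/4}
      = space (\<Pi>\<^sub>M i\<in>{..<l}. M) - {X \<in> space (\<Pi>\<^sub>M i\<in>{..<l}. M). 1/4 \<le> residual_gain N X}"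
    by auto
  ultimately show ?thesis
    by (simp add: L.prob_compl)
qed

section \<open>Stability of the iteration at fixed sample points\<close>

lemma kaczmarz_step_sum:
  "kaczmarz_step p (\<lambda>j. \<Sum>k\<in>K. c k * e k j) j = (\<Sum>k\<in>K. c k * kaczmarz_step p (e k) j)"
proof -
  have "combination (\<lambda>j. \<Sum>k\<in>K. c k * e k j) p = (\<Sum>k\<in>K. c k * combination (e k) p)"
    unfolding combination_def sum_distrib_left sum_distrib_right
    by (subst sum.swap) (simp add: mult_ac)
  then show ?thesis
    by (simp add: kaczmarz_step_def sum_subtractf right_diff_distrib sum_distrib_left sum_divide_distrib mult_ac)
qed

lemma residual_sum:
  "residual X (\<lambda>j. \<Sum>k\<in>K. c k * e k j) N = (\<lambda>j. \<Sum>k\<in>K. c k * residual X (e k) N j)"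
  by (induction N) (auto simp: kaczmarz_step_sum)

lemma kaczmarz_step_cong:
  assumes "\<And>j. j \<in> J \<Longrightarrow> x j = y j" "j \<in> J"
  shows "kaczmarz_step p x j = kaczmarz_step p y j"
  using assms by (simp add: kaczmarz_step_def combination_def)

text \<open>The operator norm is at most the Hilbert--Schmidt norm: expand \<open>x\<close> in unit
  vectors and apply the Cauchy--Schwarz inequality to each component.\<close>

lemma norm2_residual_le: "norm2 (residual X x N) \<le> residual_gain N X * norm2 x"
proof -
  let ?e = "\<lambda>k j. of_bool (j = k) :: real"
  \<comment> \<open>The expansion reproduces \<open>x\<close> only on \<open>J\<close>, so the
    equality is carried through the steps for indices in \<open>J\<close> only.\<close>
  have "residual X x N j = residual X (\<lambda>j. \<Sum>k\<in>J. x k * ?e k j) N j" if "j \<in> J" for j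
    using that
  proof (induction N arbitrary: j)
    case 0
    then show ?case
      using finite_J by (simp add: of_bool_def if_distrib[of "(*) _"] cong: if_cong)
  next
    case (Suc N)
    then show ?case
      by (auto intro: kaczmarz_step_cong)
  qed
  then have "norm2 (residual X x N) = (\<Sum>j\<in>J. (\<Sum>k\<in>J. x k * residual X (?e k) N j)\<^sup>2)"
    unfolding norm2_def by (simp add: residual_sum)
  also have "\<dots> \<le> (\<Sum>j\<in>J. (\<Sum>k\<in>J. (x k)\<^sup>2) * (\<Sum>k\<in>J. (residual X (?e k) N j)\<^sup>2))"
    by (intro sum_mono Cauchy_Schwarz_ineq_sum)
  also have "\<dots> = residual_gain N X * norm2 x"
    unfolding residual_gain_def norm2_def sum_distrib_left[symmetric]
    by (subst sum.swap) simp
  finally show ?thesis .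
qed

text \<open>A step replaces the value \<sigma> of the iterate at the sample point by the true sample
  \<open>b\<close> and changes the squared norm by
  \<open>(b\<^sup>2 - \<sigma>\<^sup>2) / dim\<close>. Dropping \<sigma> makes the squared norm grow
  linearly in \<open>N\<close>; the triangle inequality would only give quadratic growth.\<close>

lemma norm2_iterate_le:
  assumes "\<And>i. i < N \<Longrightarrow> X i \<in> space M" "\<And>i. i < N \<Longrightarrow> \<bar>combination x (X i)\<bar> \<le> \<epsilon>"
  shows "norm2 (\<lambda>j. x j - residual X x N j) \<le> real N * (\<epsilon>\<^sup>2 / dim)"
  using assms
proof (induction N)
  case 0
  then show ?case
    by (simp add: norm2_def)
next
  case (Suc N)
  define s where "s = (\<lambda>j. x j - residual X x N j)"
  let ?p = "X N"
  define b where "b = combination x ?p"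
  define \<sigma> where "\<sigma> = combination s ?p"
  have "combination (residual X x N) ?p = b - \<sigma>"
    by (simp add: b_def \<sigma>_def s_def combination_def sum_subtractf algebra_simps)
  then have "(\<lambda>j. x j - residual X x (Suc N) j) = (\<lambda>j. s j + \<phi> j ?p * ((b - \<sigma>) / dim))"
    by (simp add: s_def kaczmarz_step_def fun_eq_iff)
  moreover have "?p \<in> space M"
    using Suc.prems by simp
  ultimately have "norm2 (\<lambda>j. x j - residual X x (Suc N) j)
      = norm2 s + 2 * ((b - \<sigma>) / dim) * \<sigma> + ((b - \<sigma>) / dim)\<^sup>2 * dim"
    by (simp only: norm2_add_row \<sigma>_def)
  also have "\<dots> = norm2 s + (b\<^sup>2 - \<sigma>\<^sup>2) / dim"
    using dim_ge_1 by (simp add: field_simps power2_eq_square)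
  also have "\<dots> \<le> real N * (\<epsilon>\<^sup>2 / dim) + \<epsilon>\<^sup>2 / dim"
  proof (rule add_mono)
    show "norm2 s \<le> real N * (\<epsilon>\<^sup>2 / dim)"
      unfolding s_def using Suc by simp
    have "\<bar>b\<bar> \<le> \<epsilon>"
      unfolding b_def using Suc.prems by simp
    then have "b\<^sup>2 \<le> \<epsilon>\<^sup>2"
      using abs_ge_zero[of b] by (simp add: power2_le_iff_abs_le)
    then show "(b\<^sup>2 - \<sigma>\<^sup>2) / dim \<le> \<epsilon>\<^sup>2 / dim"
      using dim_ge_1 by (intro divide_right_mono) (auto intro: order_trans[of _ "b\<^sup>2"])
  qed
  finally show ?case
    by (simp add: algebra_simps add_divide_distrib)
qed

text \<open>Split \<open>x\<close> into residual and iterate. The residual contributes at most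
  \<open>2 * (1/4) * norm2 x\<close>, half of the left side, and is absorbed; this is the purpose of
  the threshold 1/4.\<close>

lemma norm2_le_of_small_samples:
  assumes gain: "residual_gain N X \<le> 1/4"
    and "\<And>i. i < N \<Longrightarrow> X i \<in> space M" "\<And>i. i < N \<Longrightarrow> \<bar>combination x (X i)\<bar> \<le> \<epsilon>"
  shows "norm2 x \<le> 4 * real N * \<epsilon>\<^sup>2 / dim"
proof -
  let ?r = "residual X x N"
  have "norm2 x \<le> (\<Sum>j\<in>J. 2 * (?r j)\<^sup>2 + 2 * (x j - ?r j)\<^sup>2)"
    unfolding norm2_def
  proof (rule sum_mono)
    show "(x j)\<^sup>2 \<le> 2 * (?r j)\<^sup>2 + 2 * (x j - ?r j)\<^sup>2" for j
      using zero_le_power2[of "x j - 2 * ?r j"] by (simp add: power2_eq_square algebra_simps)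
  qed
  also have "\<dots> = 2 * norm2 ?r + 2 * norm2 (\<lambda>j. x j - ?r j)"
    by (simp add: norm2_def sum.distrib sum_distrib_left)
  also have "\<dots> \<le> 2 * (1/4 * norm2 x) + 2 * (real N * (\<epsilon>\<^sup>2 / dim))"
    using gain norm2_nonneg
    by (intro add_mono mult_left_mono order_trans[OF norm2_residual_le] mult_right_mono norm2_iterate_le assms) auto
  finally show ?thesis
    by simp
qed

text \<open>Where \<open>h\<close> vanishes, its approximant is at most \<epsilon> in absolute
  value, so the previous bound applies to the coefficients. Parseval's identity turns it into a
  bound in mean square.\<close>

lemma expectation_square_le_of_sample_zeros:
  assumes gain: "residual_gain N X \<le> 1/4"
    and X: "\<And>i. i < N \<Longrightarrow> X i \<in> space M" "\<And>i. i < N \<Longrightarrow> h (X i) = 0"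
    and h: "h \<in> borel_measurable M" "\<And>p. p \<in> space M \<Longrightarrow> \<bar>h p - combination x p\<bar> \<le> \<epsilon>"
  shows "integrable M (\<lambda>p. (h p)\<^sup>2)" "expectation (\<lambda>p. (h p)\<^sup>2) \<le> (8 * real N / dim + 2) * \<epsilon>\<^sup>2"
proof -
  have le: "(h p)\<^sup>2 \<le> 2 * (combination x p)\<^sup>2 + 2 * \<epsilon>\<^sup>2" if "p \<in> space M" for p
  proof -
    have "(h p - combination x p)\<^sup>2 \<le> \<epsilon>\<^sup>2"
      using h(2)[OF that] abs_ge_zero[of "h p - combination x p"] by (simp add: power2_le_iff_abs_le)
    then show ?thesis
      using zero_le_power2[of "h p - 2 * combination x p"] by (simp add: power2_eq_square algebra_simps)
  qed
  have int: "integrable M (\<lambda>p. 2 * (combination x p)\<^sup>2 + 2 * \<epsilon>\<^sup>2)"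
    using integrable_combination_square by simp
  show "integrable M (\<lambda>p. (h p)\<^sup>2)"
    using h(1) le by (intro Bochner_Integration.integrable_bound[OF int]) (auto intro!: AE_I2)
  then have "expectation (\<lambda>p. (h p)\<^sup>2) \<le> expectation (\<lambda>p. 2 * (combination x p)\<^sup>2 + 2 * \<epsilon>\<^sup>2)"
    using int le by (intro integral_mono)
  also have "\<dots> = 2 * norm2 x + 2 * \<epsilon>\<^sup>2"
    using integrable_combination_square by (simp add: expectation_combination_square prob_space)
  also have "norm2 x \<le> 4 * real N * \<epsilon>\<^sup>2 / dim"
  proof (rule norm2_le_of_small_samples[OF gain])
    show "X i \<in> space M" if "i < N" for i
      using X(1)[OF that] .
    show "\<bar>combination x (X i)\<bar> \<le> \<epsilon>" if "i < N" for i
      using h(2)[OF X(1)[OF that]] X(2)[OF that] by simp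
  qed
  finally show "expectation (\<lambda>p. (h p)\<^sup>2) \<le> (8 * real N / dim + 2) * \<epsilon>\<^sup>2"
    by (simp add: algebra_simps)
qed

end

section \<open>Recovery from samples\<close>

lemma mixed_holder_diff_le:
  assumes mh: "mixed_holder c \<alpha> f"
    and "x \<in> {0..1}" "x' \<in> {0..1}" "y \<in> {0..1}" "y' \<in> {0..1}"
  shows "\<bar>f (x', y') - f (x, y)\<bar> \<le> c * \<bar>x' - x\<bar> powr \<alpha> + c * \<bar>y' - y\<bar> powr \<alpha>"
proof -
  have "\<bar>f (x', y') - f (x, y')\<bar> \<le> c * \<bar>x' - x\<bar> powr \<alpha>"
    "\<bar>f (x, y') - f (x, y)\<bar> \<le> c * \<bar>y' - y\<bar> powr \<alpha>"
    using assms unfolding mixed_holder_def by blast+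
  then show ?thesis
    by linarith
qed

lemma mixed_holder_oscillation:
  assumes "mixed_holder c \<alpha> f" "c > 0" "\<alpha> > 0" "p \<in> {0..1} \<times> {0..1}" "q \<in> {0..1} \<times> {0..1}"
  shows "\<bar>f p - f q\<bar> \<le> 2 * c"
proof -
  obtain x y x' y' where pq: "p = (x', y')" "q = (x, y)"
    by fastforce
  have "\<bar>x' - x\<bar> powr \<alpha> \<le> 1" "\<bar>y' - y\<bar> powr \<alpha> \<le> 1"
    using assms by (auto simp: pq intro!: powr_le1)
  then have "c * \<bar>x' - x\<bar> powr \<alpha> \<le> c" "c * \<bar>y' - y\<bar> powr \<alpha> \<le> c"
    using \<open>c > 0\<close> by auto
  moreover have "\<bar>f (x', y') - f (x, y)\<bar> \<le> c * \<bar>x' - x\<bar> powr \<alpha> + c * \<bar>y' - y\<bar> powr \<alpha>"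
    using assms by (intro mixed_holder_diff_le) (auto simp: pq)
  ultimately show ?thesis
    unfolding pq by linarith
qed

lemma mixed_holder_diff:
  assumes "mixed_holder c \<alpha> f" "mixed_holder c \<alpha> g"
  shows "mixed_holder (2 * c) \<alpha> (\<lambda>p. f p - g p)"
  unfolding mixed_holder_def
proof (intro ballI conjI)
  fix x x' y y' :: real
  assume xy: "x \<in> {0..1}" "x' \<in> {0..1}" "y \<in> {0..1}" "y' \<in> {0..1}"
  have "\<bar>f (x', y) - f (x, y)\<bar> \<le> c * \<bar>x' - x\<bar> powr \<alpha>" "\<bar>g (x', y) - g (x, y)\<bar> \<le> c * \<bar>x' - x\<bar> powr \<alpha>"
    using assms xy unfolding mixed_holder_def by blast+
  then show "\<bar>f (x', y) - g (x', y) - (f (x, y) - g (x, y))\<bar> \<le> 2 * c * \<bar>x' - x\<bar> powr \<alpha>"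
    by linarith
  have "\<bar>f (x, y') - f (x, y)\<bar> \<le> c * \<bar>y' - y\<bar> powr \<alpha>" "\<bar>g (x, y') - g (x, y)\<bar> \<le> c * \<bar>y' - y\<bar> powr \<alpha>"
    using assms xy unfolding mixed_holder_def by blast+
  then show "\<bar>f (x, y') - g (x, y') - (f (x, y) - g (x, y))\<bar> \<le> 2 * c * \<bar>y' - y\<bar> powr \<alpha>"
    by linarith
  have "\<bar>f (x', y') - f (x, y') - f (x', y) + f (x, y)\<bar> \<le> c * (\<bar>x' - x\<bar> * \<bar>y' - y\<bar>) powr \<alpha>"
    "\<bar>g (x', y') - g (x, y') - g (x', y) + g (x, y)\<bar> \<le> c * (\<bar>x' - x\<bar> * \<bar>y' - y\<bar>) powr \<alpha>"
    using assms xy unfolding mixed_holder_def by blast+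
  then show "\<bar>f (x', y') - g (x', y') - (f (x, y') - g (x, y')) - (f (x', y) - g (x', y))
      + (f (x, y) - g (x, y))\<bar> \<le> 2 * c * (\<bar>x' - x\<bar> * \<bar>y' - y\<bar>) powr \<alpha>"
    by linarith
qed

lemma tendsto_abs_powr_zero:
  fixes g :: "'a \<Rightarrow> real"
  assumes "(g \<longlongrightarrow> 0) F" "a > 0"
  shows "((\<lambda>x. \<bar>g x\<bar> powr a) \<longlongrightarrow> 0) F"
  using assms by (intro tendsto_zero_powrI[where b = a] tendsto_rabs_zero) auto

lemma mixed_holder_measurable:
  assumes "mixed_holder c \<alpha> f" "\<alpha> > 0"
  shows "f \<in> borel_measurable unit_square"
proof -
  have "continuous_on ({0..1} \<times> {0..1}) f"
    unfolding continuous_on_def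
  proof
    fix p :: "real \<times> real" assume p: "p \<in> {0..1} \<times> {0..1}"
    let ?F = "at p within {0..1} \<times> {0..1}"
    define b where "b q = c * \<bar>fst q - fst p\<bar> powr \<alpha> + c * \<bar>snd q - snd p\<bar> powr \<alpha>" for q
    have "((\<lambda>q. fst q - fst p) \<longlongrightarrow> 0) ?F" "((\<lambda>q. snd q - snd p) \<longlongrightarrow> 0) ?F"
      by (auto intro!: tendsto_eq_intros)
    with \<open>\<alpha> > 0\<close> have "(b \<longlongrightarrow> 0) ?F"
      unfolding b_def by (intro tendsto_add_zero tendsto_mult_right_zero tendsto_abs_powr_zero)
    moreover have "\<forall>\<^sub>F q in ?F. norm (f q - f p) \<le> b q"
      unfolding eventually_at_topological
    proof (intro exI[of _ UNIV] conjI ballI impI)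
      fix q :: "real \<times> real" assume "q \<in> {0..1} \<times> {0..1}"
      with p show "norm (f q - f p) \<le> b q"
        using mixed_holder_diff_le[OF assms(1), of "fst p" "fst q" "snd p" "snd q"]
        by (auto simp: b_def)
    qed auto
    ultimately have "((\<lambda>q. f q - f p) \<longlongrightarrow> 0) ?F"
      by (rule Lim_null_comparison[rotated])
    then show "(f \<longlongrightarrow> f p) ?F"
      by (rule LIM_zero_cancel)
  qed
  then have "f \<in> borel_measurable (restrict_space borel ({0..1} \<times> {0..1}))"
    by (rule borel_measurable_continuous_on_restrict)
  then show ?thesis
    using measurable_cong_sets[OF sets_unit_square refl] by blast
qed

text \<open>Difference quotients are bounded by
  \<open>c * \<bar>y - x\<bar> powr (\<alpha> - 1)\<close>, which tends to 0, so the derivative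
  vanishes everywhere.\<close>

lemma holder_gt_1_constant:
  fixes f :: "real \<Rightarrow> real"
  assumes "\<alpha> > 1"
    and holder: "\<And>x x'. x \<in> {0..1} \<Longrightarrow> x' \<in> {0..1} \<Longrightarrow> \<bar>f x' - f x\<bar> \<le> c * \<bar>x' - x\<bar> powr \<alpha>"
    and "x \<in> {0..1}" "x' \<in> {0..1}"
  shows "f x' = f x"
proof -
  have "(f has_derivative (\<lambda>h. 0)) (at x within {0..1})" if x: "x \<in> {0..1}" for x
    unfolding has_derivative_within
  proof (intro conjI)
    let ?F = "at x within {0..1}"
    have "((\<lambda>y. y - x) \<longlongrightarrow> 0) ?F"
      by (auto intro!: tendsto_eq_intros)
    with \<open>\<alpha> > 1\<close> have "((\<lambda>y. c * \<bar>y - x\<bar> powr (\<alpha> - 1)) \<longlongrightarrow> 0) ?F"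
      by (intro tendsto_mult_right_zero tendsto_abs_powr_zero) simp_all
    moreover have "\<forall>\<^sub>F y in ?F. norm ((1 / norm (y - x)) *\<^sub>R (f y - (f x + 0))) \<le> c * \<bar>y - x\<bar> powr (\<alpha> - 1)"
      unfolding eventually_at_topological
    proof (intro exI[of _ UNIV] conjI ballI impI)
      fix y assume y: "y \<in> {0..1}" "y \<noteq> x"
      with holder[OF x y(1)]
      show "norm ((1 / norm (y - x)) *\<^sub>R (f y - (f x + 0))) \<le> c * \<bar>y - x\<bar> powr (\<alpha> - 1)"
        by (simp add: powr_diff divide_right_mono)
    qed auto
    ultimately show "((\<lambda>y. (1 / norm (y - x)) *\<^sub>R (f y - (f x + 0))) \<longlongrightarrow> 0) ?F"
      by (rule Lim_null_comparison[rotated])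
  qed simp
  then obtain k where "\<And>x. x \<in> {0..1} \<Longrightarrow> f x = k"
    using has_derivative_zero_constant[of "{0..1::real}" f] by auto
  with assms show ?thesis
    by simp
qed

lemma mixed_holder_gt_1_constant:
  assumes mh: "mixed_holder c \<alpha> f" and "\<alpha> > 1"
    and "p \<in> {0..1} \<times> {0..1}" "q \<in> {0..1} \<times> {0..1}"
  shows "f p = f q"
proof -
  obtain x y x' y' where pq [simp]: "p = (x', y')" "q = (x, y)"
    by fastforce
  have "f (x', y') = f (x, y')"
    using assms unfolding mixed_holder_def
    by (intro holder_gt_1_constant[of \<alpha> "\<lambda>u. f (u, y')" c]) auto
  also have "\<dots> = f (x, y)"
    using assms unfolding mixed_holder_def
    by (intro holder_gt_1_constant[of \<alpha> "\<lambda>v. f (x, v)" c]) auto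
  finally show ?thesis
    by simp
qed

section \<open>Norm bounds on the square and recovery by interpolation\<close>

interpretation unit_square: prob_space unit_square
  by (rule prob_space_unit_square)

lemma L2_norm_le:
  assumes "f \<in> borel_measurable unit_square" "\<And>p. p \<in> {0..1} \<times> {0..1} \<Longrightarrow> \<bar>f p\<bar> \<le> B"
  shows "square_integrable f" "L2_norm f \<le> B"
proof -
  have le: "(f p)\<^sup>2 \<le> B\<^sup>2" if "p \<in> {0..1} \<times> {0..1}" for p
    using assms(2)[OF that] by (simp add: abs_le_square_iff[symmetric])
  have B: "B \<ge> 0"
    using assms(2)[of "(0, 0)"] by auto
  have int: "integrable unit_square (\<lambda>p. (f p)\<^sup>2)"
    using assms(1) le by (intro unit_square.integrable_const_bound[of _ "B\<^sup>2"]) auto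
  with assms(1) show "square_integrable f"
    by (simp add: square_integrable_def)
  have "(\<integral>p. (f p)\<^sup>2 \<partial>unit_square) \<le> (\<integral>p. B\<^sup>2 \<partial>unit_square)"
    using int le by (intro integral_mono) auto
  then show "L2_norm f \<le> B"
    using B by (simp add: L2_norm_def unit_square.prob_space[unfolded space_unit_square] real_le_lsqrt)
qed

lemma L2_norm_ge:
  assumes "square_integrable f" "B \<ge> 0" "\<And>p. p \<in> {0..1} \<times> {0..1} \<Longrightarrow> B \<le> \<bar>f p\<bar>"
  shows "B \<le> L2_norm f"
proof -
  have "B\<^sup>2 \<le> (f p)\<^sup>2" if "p \<in> {0..1} \<times> {0..1}" for p
    using assms(3)[OF that] \<open>B \<ge> 0\<close> by (simp add: abs_le_square_iff[symmetric])
  then have "(\<integral>p. B\<^sup>2 \<partial>unit_square) \<le> (\<integral>p. (f p)\<^sup>2 \<partial>unit_square)"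
    using assms(1) by (intro integral_mono) (auto simp: square_integrable_def)
  then show ?thesis
    by (simp add: L2_norm_def unit_square.prob_space[unfolded space_unit_square] real_le_rsqrt)
qed

lemma uniform_samples_space:
  assumes "X \<in> space (uniform_samples l)" "i < l"
  shows "X i \<in> {0..1} \<times> {0..1}"
  using assms by (auto simp: uniform_samples_def space_PiM PiE_iff)

text \<open>Off the good event \<open>G\<close> the reconstruction is deliberately made far from \<open>f\<close>, so that the
  event of success is \<open>G\<close> itself and its measurability is not an issue.\<close>

lemma optimal_recovery:
  assumes "c > 0" "\<alpha> > 0" "l > 0" and G: "G \<in> sets (uniform_samples l)"
    and zeros: "\<And>X h. X \<in> G \<Longrightarrow> mixed_holder (2 * c) \<alpha> h \<Longrightarrow> (\<And>i. i < l \<Longrightarrow> h (X i) = 0) \<Longrightarrow> L2_norm h \<le> B"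
  shows "\<exists>R. \<forall>f. mixed_holder c \<alpha> f \<longrightarrow>
    {X \<in> space (uniform_samples l).
      square_integrable (\<lambda>p. f p - R X (sample_values l f X) p) \<and>
      L2_norm (\<lambda>p. f p - R X (sample_values l f X) p) \<le> B} = G"
proof -
  \<comment> \<open>As \<open>f\<close> oscillates by at most \<open>2 * c\<close>, the constant
    \<open>f (X 0) + K\<close> stays at distance at least \<open>\<bar>B\<bar> + 1\<close> from
    \<open>f\<close> everywhere.\<close>
  define K where "K = 2 * c + \<bar>B\<bar> + 1"
  define R where "R X v = (if X \<in> G then SOME g. mixed_holder c \<alpha> g \<and> (\<forall>i<l. g (X i) = v i)
    else (\<lambda>p. v 0 + K))" for X :: "nat \<Rightarrow> real \<times> real" and v :: "nat \<Rightarrow> real"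
  have "square_integrable (\<lambda>p. f p - R X (sample_values l f X) p)
      \<and> L2_norm (\<lambda>p. f p - R X (sample_values l f X) p) \<le> B \<longleftrightarrow> X \<in> G"
    if f: "mixed_holder c \<alpha> f" and X: "X \<in> space (uniform_samples l)" for f X
  proof (cases "X \<in> G")
    case True
    let ?P = "\<lambda>g. mixed_holder c \<alpha> g \<and> (\<forall>i<l. g (X i) = sample_values l f X i)"
    define g where "g = R X (sample_values l f X)"
    \<comment> \<open>The unknown \<open>f\<close> itself shows that an interpolant exists; the
      choice of \<open>g\<close> depends on the data only.\<close>
    have "?P f"
      using f by (simp add: sample_values_def)
    then have "?P (Eps ?P)"
      by (rule someI[of ?P])
    then have g: "mixed_holder c \<alpha> g" "\<And>i. i < l \<Longrightarrow> g (X i) = f (X i)"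
      using True by (auto simp: g_def R_def sample_values_def)
    have h: "mixed_holder (2 * c) \<alpha> (\<lambda>p. f p - g p)"
      using f g(1) by (rule mixed_holder_diff)
    have "L2_norm (\<lambda>p. f p - g p) \<le> B"
      using True h g(2) by (intro zeros[of X]) auto
    moreover have "square_integrable (\<lambda>p. f p - g p)"
    proof (rule L2_norm_le)
      fix p :: "real \<times> real" assume "p \<in> {0..1} \<times> {0..1}"
      moreover have "X 0 \<in> {0..1} \<times> {0..1}"
        using uniform_samples_space[OF X \<open>l > 0\<close>] .
      ultimately show "\<bar>f p - g p\<bar> \<le> 4 * c"
        using mixed_holder_oscillation[OF h, of p "X 0"] g(2)[OF \<open>l > 0\<close>] assms(1,2) by simp
    qed (use mixed_holder_measurable[OF h \<open>\<alpha> > 0\<close>] in simp)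
    ultimately show ?thesis
      using True by (simp add: g_def)
  next
    case False
    have "\<not> L2_norm (\<lambda>p. f p - (f (X 0) + K)) \<le> B" if "square_integrable (\<lambda>p. f p - (f (X 0) + K))"
    proof -
      have "\<bar>B\<bar> + 1 \<le> L2_norm (\<lambda>p. f p - (f (X 0) + K))"
        using that
      proof (rule L2_norm_ge)
        fix p :: "real \<times> real" assume "p \<in> {0..1} \<times> {0..1}"
        from mixed_holder_oscillation[OF f assms(1,2) this uniform_samples_space[OF X \<open>l > 0\<close>]]
        show "\<bar>B\<bar> + 1 \<le> \<bar>f p - (f (X 0) + K)\<bar>"
          by (simp add: K_def)
      qed simp
      then show ?thesis
        by simp
    qed
    with False \<open>l > 0\<close> show ?thesis
      by (auto simp: R_def sample_values_def)
  qed
  moreover have "G \<subseteq> space (uniform_samples l)"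
    using G by (rule sets.sets_into_space)
  ultimately show ?thesis
    by (intro exI[of _ R]) blast
qed

section \<open>The Walsh system of the hyperbolic cross on the square\<close>

definition walsh2 :: "nat \<times> nat \<Rightarrow> real \<times> real \<Rightarrow> real" where
  "walsh2 = (\<lambda>(i, j) p. walsh i (fst p) * walsh j (snd p))"

interpretation walsh2: unimodular_orthonormal_system unit_square "hyperbolic_cross m" walsh2 for m
proof
  show "walsh2 q \<in> borel_measurable unit_square" for q
    unfolding walsh2_def unit_square_def case_prod_unfold
    by (intro measurable_restrict_space1 borel_measurable_times measurable_compose[OF _ borel_measurable_walsh])
      (auto intro!: borel_measurable_continuous_onI continuous_intros)
  show "(walsh2 q p)\<^sup>2 = 1" for q p
    by (simp add: walsh2_def case_prod_unfold power_mult_distrib)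
  show "unit_square.expectation (\<lambda>p. walsh2 q p * walsh2 q' p) = of_bool (q = q')" for q q'
  proof -
    obtain i j i' j' where [simp]: "q = (i, j)" "q' = (i', j')"
      by fastforce
    have "unit_square.expectation (\<lambda>p. walsh2 q p * walsh2 q' p)
        = (\<integral>p. (walsh i (fst p) * walsh i' (fst p)) * (walsh j (snd p) * walsh j' (snd p)) \<partial>unit_square)"
      by (simp add: walsh2_def mult_ac)
    also have "\<dots> = of_bool (i = i') * of_bool (j = j')"
      by (subst integral_unit_square_product[of "\<lambda>x. walsh i x * walsh i' x" "\<lambda>y. walsh j y * walsh j' y"])
        (simp_all add: unit_mean_walsh abs_mult)
    finally show ?thesis
      by auto
  qed
qed (simp_all add: finite_hyperbolic_cross hyperbolic_cross_nonempty)

lemma L2_norm_le_of_sample_zeros: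
  assumes gain: "walsh2.residual_gain m N X \<le> 1/4" and "N \<le> l" "X \<in> space (uniform_samples l)"
    and h: "mixed_holder c \<alpha> h" "\<alpha> > 0" and zeros: "\<And>i. i < l \<Longrightarrow> h (X i) = 0"
  shows "L2_norm h \<le> sqrt (8 * real N / walsh2.dim m + 2) * (c * (real m + 2) * (1 / 2 ^ m) powr \<alpha>)"
proof -
  define \<epsilon> where "\<epsilon> = c * (real m + 2) * (1 / 2 ^ m) powr \<alpha>"
  obtain a where a: "\<And>x y. x \<in> {0..1} \<Longrightarrow> y \<in> {0..1} \<Longrightarrow>
      \<bar>h (x, y) - (\<Sum>(i, j)\<in>hyperbolic_cross m. a (i, j) * (walsh i x * walsh j y))\<bar> \<le> \<epsilon>"
    using mixed_holder_approximation[OF h, of m] unfolding \<epsilon>_def by blast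
  have approx: "\<bar>h p - walsh2.combination m a p\<bar> \<le> \<epsilon>" if "p \<in> space unit_square" for p
    using a[of "fst p" "snd p"] that
    unfolding walsh2.combination_def by (auto simp: walsh2_def case_prod_unfold)
  have "\<epsilon> \<ge> 0"
    using approx[of "(0, 0)"] by simp
  have "(\<integral>p. (h p)\<^sup>2 \<partial>unit_square) \<le> (8 * real N / walsh2.dim m + 2) * \<epsilon>\<^sup>2"
  proof (rule walsh2.expectation_square_le_of_sample_zeros(2)[OF gain])
    show "X i \<in> space unit_square" "h (X i) = 0" if "i < N" for i
      using that assms uniform_samples_space[of X l i] by auto
  qed (use approx mixed_holder_measurable[OF h] in auto)
  then have "L2_norm h \<le> sqrt ((8 * real N / walsh2.dim m + 2) * \<epsilon>\<^sup>2)"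
    by (simp add: L2_norm_def)
  with \<open>\<epsilon> \<ge> 0\<close> show ?thesis
    by (simp add: real_sqrt_mult \<epsilon>_def)
qed

section \<open>Choice of the parameters\<close>

lemma dyadic_scale_exists:
  fixes n :: nat
  assumes "n \<ge> 16"
  obtains m where "16 * 2 ^ m \<le> n" "n < 32 * 2 ^ m" "real m + 2 \<le> 2 * ln (real n)"
proof -
  have "1 \<le> n div 16"
    using assms by linarith
  then obtain m where m: "2 ^ m \<le> n div 16" "n div 16 < 2 ^ (m + 1)"
    using ex_power_ivl1[of 2 "n div 16"] by blast
  have "16 * 2 ^ m \<le> n" "n < 32 * 2 ^ m"
    using m by auto
  moreover have "real m + 2 \<le> 2 * ln (real n)"
  proof -
    have "2 ^ (m + 4) \<le> real n"
      using of_nat_mono[OF \<open>16 * 2 ^ m \<le> n\<close>, where 'a = real] by (simp add: power_add)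
    then have "ln (2 ^ (m + 4)) \<le> ln (real n)"
      using assms by (intro ln_mono) auto
    then have "real (m + 4) * ln 2 \<le> ln (real n)"
      by (simp add: ln_realpow)
    moreover have "real (m + 4) * (2 / 3) \<le> real (m + 4) * ln 2"
      using ln2_ge_two_thirds by (intro mult_left_mono) auto
    ultimately show ?thesis
      by simp
  qed
  ultimately show ?thesis
    by (rule that)
qed

text \<open>With about \<open>c1 * D * L\<close> steps the contraction factor is at most
  \<open>real n powr (- c1)\<close>. The prefactor \<open>4 * D\<close> is at most \<open>n\<close>
  squared, hence the exponent \<open>2 - c1\<close>. The ratio \<open>N / D\<close> is of order
  \<open>L\<close>, and its root joins the factor \<open>m + 2\<close> of the approximation error to
  give the power 3/2.\<close>

lemma recovery_large_n:
  fixes n l :: nat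
  assumes "c > 0" "c1 > 2" "0 < \<alpha>" "\<alpha> \<le> 1" "n \<ge> 16" and l: "real l \<ge> c1 * real n * (ln (real n))\<^sup>2"
  defines "B \<equiv> 256 * c * sqrt (8 * c1 + 10) * (real n powr (- \<alpha>) * ln (real n) powr (3 / 2))"
  shows "\<exists>G\<in>sets (uniform_samples l). measure (uniform_samples l) G \<ge> 1 - real n powr (2 - c1) \<and>
    (\<forall>X\<in>G. \<forall>h. mixed_holder (2 * c) \<alpha> h \<longrightarrow> (\<forall>i<l. h (X i) = 0) \<longrightarrow> L2_norm h \<le> B)"
proof -
  obtain m where m: "16 * 2 ^ m \<le> n" "n < 32 * 2 ^ m" "real m + 2 \<le> 2 * ln (real n)"
    using dyadic_scale_exists[OF \<open>n \<ge> 16\<close>] .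
  define L where "L = ln (real n)"
  define D where "D = walsh2.dim m"
  define N where "N = nat \<lceil>c1 * D * L\<rceil>"
  have L: "L \<ge> 1"
    using m(3) unfolding L_def by linarith
  have D1: "D \<ge> 1"
    unfolding D_def by (rule walsh2.dim_ge_1)
  have D: "D \<le> L * real n / 8"
  proof -
    have "D \<le> real (Suc m * 2 ^ m)"
      unfolding D_def walsh2.dim_def using card_hyperbolic_cross_le of_nat_le_iff by blast
    also have "\<dots> = (real m + 1) * 2 ^ m"
      by (simp add: algebra_simps)
    also have "\<dots> \<le> (2 * L) * (real n / 16)"
    proof (rule mult_mono)
      have "real (16 * 2 ^ m) \<le> real n"
        using m(1) by (rule of_nat_mono)
      then show "2 ^ m \<le> real n / 16"
        by simp
    qed (use m(3) L in \<open>auto simp: L_def\<close>)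
    finally show ?thesis
      by simp
  qed
  have N_ge: "c1 * D * L \<le> real N"
    unfolding N_def by linarith
  have N_le: "real N \<le> c1 * D * L + 1"
  proof -
    have "0 \<le> c1 * D * L"
      using \<open>c1 > 2\<close> D1 L by simp
    then show ?thesis
      unfolding N_def by linarith
  qed
  have "N \<le> l"
  proof -
    have "c1 * D * L \<le> c1 * (L * real n / 8) * L"
      using D \<open>c1 > 2\<close> L by (intro mult_right_mono mult_left_mono) auto
    \<comment> \<open>The slack 16 in the choice of \<open>m\<close> brings
      \<open>c1 * D * L\<close> down to an eighth of the available bound; the 1 lost by rounding
      \<open>N\<close> up is at most 1/32 of it.\<close>
    moreover have "2 * 16 * 1 \<le> c1 * real n * L\<^sup>2"
      using assms(2,5) L by (intro mult_mono one_le_power) auto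
    ultimately have "real N \<le> c1 * real n * L\<^sup>2"
      using N_le by (simp add: power2_eq_square mult_ac)
    with l show ?thesis
      by (simp add: L_def)
  qed
  define G where "G = {X \<in> space (uniform_samples l). walsh2.residual_gain m N X < 1/4}"
  have "G \<in> sets (uniform_samples l)"
    using walsh2.measurable_residual_gain[OF \<open>N \<le> l\<close>] unfolding G_def uniform_samples_def by measurable
  moreover have "measure (uniform_samples l) G \<ge> 1 - real n powr (2 - c1)"
  proof -
    have "(1 - 1 / D) ^ N \<le> exp (- (1 / D)) ^ N"
      using D1 exp_ge_add_one_self[of "- (1 / D)"] by (intro power_mono) auto
    also have "\<dots> = exp (- (real N / D))"
      by (simp flip: exp_of_nat_mult)
    also have "\<dots> \<le> exp (- (c1 * L))"
      using N_ge D1 by (simp add: field_simps)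
    also have "\<dots> = real n powr (- c1)"
      using assms(5) by (simp add: powr_def L_def)
    finally have "4 * D * (1 - 1 / D) ^ N \<le> 4 * D * real n powr (- c1)"
      using D1 by simp
    also have "\<dots> \<le> (real n)\<^sup>2 * real n powr (- c1)"
    proof (rule mult_right_mono)
      have "L \<le> real n"
        unfolding L_def using ln_le_minus_one[of "real n"] assms(5) by simp
      then have "L * real n \<le> real n * real n"
        by (intro mult_right_mono) auto
      with D D1 show "4 * D \<le> (real n)\<^sup>2"
        unfolding power2_eq_square by linarith
    qed simp
    also have "\<dots> = real n powr (2 - c1)"
      using assms(5) by (simp add: powr_diff powr_minus divide_inverse flip: powr_numeral)
    finally show ?thesis
      using walsh2.prob_residual_gain_less[OF \<open>N \<le> l\<close>, of m]
      unfolding G_def D_def uniform_samples_def by linarith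
  qed
  moreover have "L2_norm h \<le> B"
    if X: "X \<in> G" and h: "mixed_holder (2 * c) \<alpha> h" "\<forall>i<l. h (X i) = 0" for X h
  proof -
    have "L2_norm h \<le> sqrt (8 * real N / D + 2) * (2 * c * (real m + 2) * (1 / 2 ^ m) powr \<alpha>)"
      unfolding D_def using X h \<open>N \<le> l\<close> \<open>\<alpha> > 0\<close>
      by (intro L2_norm_le_of_sample_zeros[where X = X and l = l]) (auto simp: G_def)
    also have "\<dots> \<le> (sqrt (8 * c1 + 10) * sqrt L) * (2 * c * (2 * L) * (32 * real n powr (- \<alpha>)))"
    proof (intro mult_mono)
      have "8 * real N / D + 2 \<le> 8 * (c1 * D * L + 1) / D + 2"
        using N_le D1 by (simp add: divide_right_mono)
      also have "\<dots> = 8 * c1 * L + 8 / D + 2"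
        using D1 by (simp add: field_simps)
      also have "\<dots> \<le> 8 * c1 * L + 8 * L + 2 * L"
        using D1 L mult_mono[of 1 D 1 L] by (intro add_mono) (auto simp: field_simps)
      finally have "8 * real N / D + 2 \<le> (8 * c1 + 10) * L"
        by (simp add: algebra_simps)
      then show "sqrt (8 * real N / D + 2) \<le> sqrt (8 * c1 + 10) * sqrt L"
        by (simp flip: real_sqrt_mult)
      have "real n < real (32 * 2 ^ m)"
        using m(2) by (simp only: of_nat_less_iff)
      then have "1 / 2 ^ m \<le> 32 / real n"
        using assms(5) by (simp add: field_simps)
      then have "(1 / 2 ^ m) powr \<alpha> \<le> (32 / real n) powr \<alpha>"
        using \<open>\<alpha> > 0\<close> by (intro powr_mono2) auto
      also have "\<dots> = 32 powr \<alpha> * real n powr (- \<alpha>)"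
        by (subst powr_divide) (auto simp: powr_minus divide_inverse)
      \<comment> \<open>Here \<open>\<alpha> \<le> 1\<close> keeps the constant independent of
        \<alpha>.\<close>
      also have "32 powr \<alpha> \<le> (32::real)"
        using powr_mono[OF \<open>\<alpha> \<le> 1\<close>, of 32] by simp
      finally show "(1 / 2 ^ m) powr \<alpha> \<le> 32 * real n powr (- \<alpha>)"
        by (simp add: mult_right_mono)
    qed (use assms m(3) L in \<open>auto simp: L_def\<close>)
    also have "\<dots> = 128 * c * sqrt (8 * c1 + 10) * (real n powr (- \<alpha>) * (L * sqrt L))"
      by simp
    also have "L * sqrt L = L powr (3 / 2)"
      using L by (simp add: powr_half_sqrt[symmetric] powr_mult_base)
    \<comment> \<open>The larger constant 256 in \<open>B\<close> is dictated by the case of small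
      \<open>n\<close>, where it arises as 4 times 64.\<close>
    also have "128 * c * sqrt (8 * c1 + 10) * (real n powr (- \<alpha>) * L powr (3 / 2)) \<le> B"
      unfolding B_def L_def using assms by (intro mult_right_mono) auto
    finally show ?thesis .
  qed
  ultimately show ?thesis
    by blast
qed

text \<open>For such \<open>n\<close> the rate is bounded below:
  \<open>real n powr (- \<alpha>)\<close> is at least 1/16 and the logarithmic factor at least 1/4.
  A trivial bound by a constant therefore has the required form.\<close>

lemma small_n_bound:
  fixes n :: nat
  assumes "2 \<le> n" "n < 16" "0 < \<alpha>" "\<alpha> \<le> 1"
  shows "1 \<le> 64 * (real n powr (- \<alpha>) * ln (real n) powr (3 / 2))"
proof -
  have "1 / 16 \<le> real n powr (- 1)"
    using assms by (simp add: powr_minus divide_simps)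
  also have "\<dots> \<le> real n powr (- \<alpha>)"
    using assms by (intro powr_mono) auto
  finally have 1: "1 / 16 \<le> real n powr (- \<alpha>)" .
  have "1 / 2 \<le> ln (real n)"
  proof -
    have "ln 2 \<le> ln (real n)"
      using assms by (intro ln_mono) auto
    with ln2_ge_two_thirds show ?thesis
      by linarith
  qed
  then have "(1 / 2) powr (3 / 2) \<le> ln (real n) powr (3 / 2)"
    by (intro powr_mono2) auto
  moreover have "(1 / 2) powr 2 \<le> (1 / 2 :: real) powr (3 / 2)"
    by (intro powr_mono') auto
  ultimately have 2: "1 / 4 \<le> ln (real n) powr (3 / 2)"
    by (simp add: power2_eq_square)
  have "1 / 16 * (1 / 4) \<le> real n powr (- \<alpha>) * ln (real n) powr (3 / 2)"
    using 1 2 by (intro mult_mono) auto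
  then show ?thesis
    by simp
qed

theorem theorem1p1:
  fixes c c1 :: real
  assumes "c > 0" and "c1 > 0"
  shows "\<exists>C>0. \<forall>\<alpha>>0. \<forall>n::nat. \<forall>l::nat.
    n \<ge> 1 \<longrightarrow> real l \<ge> c1 * real n * (ln (real n))\<^sup>2 \<longrightarrow>
    (\<exists>R :: (nat \<Rightarrow> real \<times> real) \<Rightarrow> (nat \<Rightarrow> real) \<Rightarrow> (real \<times> real \<Rightarrow> real).
      \<forall>f. mixed_holder c \<alpha> f \<longrightarrow>
        measure (uniform_samples l)
          {X \<in> space (uniform_samples l).
            square_integrable (\<lambda>p. f p - R X (sample_values l f X) p) \<and>
            L2_norm (\<lambda>p. f p - R X (sample_values l f X) p)
              \<le> C * (real n powr (- \<alpha>) * ln (real n) powr (3 / 2))}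
        \<ge> 1 - real n powr (2 - c1))"
proof (intro exI[of _ "256 * c * sqrt (8 * c1 + 10)"] conjI allI impI)
  let ?C = "256 * c * sqrt (8 * c1 + 10)"
  show "?C > 0"
    using assms by simp
  fix \<alpha> :: real and n l :: nat
  assume \<alpha>: "\<alpha> > 0" and n: "n \<ge> 1" and l: "real l \<ge> c1 * real n * (ln (real n))\<^sup>2"
  let ?B = "?C * (real n powr (- \<alpha>) * ln (real n) powr (3 / 2))"
  show "\<exists>R. \<forall>f. mixed_holder c \<alpha> f \<longrightarrow>
    measure (uniform_samples l)
      {X \<in> space (uniform_samples l).
        square_integrable (\<lambda>p. f p - R X (sample_values l f X) p) \<and>
        L2_norm (\<lambda>p. f p - R X (sample_values l f X) p) \<le> ?B} \<ge> 1 - real n powr (2 - c1)"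
  \<comment> \<open>In these cases \<open>real n powr (2 - c1)\<close> is at least 1, so the claimed
    probability bound is at most 0 and any \<open>R\<close> will do.\<close>
  proof (cases "n = 1 \<or> c1 \<le> 2")
    case True
    then have "1 - real n powr (2 - c1) \<le> 0"
      using n by (auto intro: ge_one_powr_ge_zero)
    then show ?thesis
      by (meson measure_nonneg order_trans)
  next
    case False
    then have n2: "n \<ge> 2" and c1: "c1 > 2"
      using n by auto
    have "0 < c1 * real n * (ln (real n))\<^sup>2"
      using n2 assms by simp
    with l have "l > 0"
      by (cases l) auto
    interpret P: prob_space "uniform_samples l"
      unfolding uniform_samples_def by (intro prob_space_PiM prob_space_unit_square)
    have "\<exists>G\<in>sets (uniform_samples l). measure (uniform_samples l) G \<ge> 1 - real n powr (2 - c1) \<and>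
      (\<forall>X\<in>G. \<forall>h. mixed_holder (2 * c) \<alpha> h \<longrightarrow> (\<forall>i<l. h (X i) = 0) \<longrightarrow> L2_norm h \<le> ?B)"
    proof (cases "n \<ge> 16 \<and> \<alpha> \<le> 1")
      case True
      with assms \<alpha> c1 l show ?thesis
        by (intro recovery_large_n) auto
    next
      case False
      \<comment> \<open>If \<alpha> exceeds 1 or \<open>n\<close> is below 16, no sample is bad and
        the whole space serves as \<open>G\<close>: a zero at \<open>X 0\<close> alone forces
        \<open>h\<close> to be small, because \<open>h\<close> is constant or by its bounded
        oscillation.\<close>
      have "L2_norm h \<le> ?B"
        if X: "X \<in> space (uniform_samples l)" and h: "mixed_holder (2 * c) \<alpha> h" "\<forall>i<l. h (X i) = 0" for X h
      proof (rule L2_norm_le(2))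
        show "h \<in> borel_measurable unit_square"
          using h(1) \<alpha> by (rule mixed_holder_measurable)
        fix p :: "real \<times> real" assume p: "p \<in> {0..1} \<times> {0..1}"
        have X0: "X 0 \<in> {0..1} \<times> {0..1}" "h (X 0) = 0"
          using uniform_samples_space[OF X \<open>l > 0\<close>] h(2) \<open>l > 0\<close> by auto
        show "\<bar>h p\<bar> \<le> ?B"
        proof (cases "\<alpha> > 1")
          case True
          then have "h p = 0"
            using mixed_holder_gt_1_constant[OF h(1) True p X0(1)] X0(2) by simp
          then show ?thesis
            using assms by simp
        next
          case \<alpha>1: False
          have "\<bar>h p\<bar> \<le> 4 * c"
            using mixed_holder_oscillation[OF h(1) _ \<alpha> p X0(1)] X0(2) assms by simp
          also have "\<dots> \<le> 4 * c * (64 * (real n powr (- \<alpha>) * ln (real n) powr (3 / 2)))"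
            using small_n_bound[of n \<alpha>] n2 False \<alpha>1 \<alpha> assms mult_left_mono[of 1 _ "4 * c"] by simp
          also have "\<dots> = 256 * c * 1 * (real n powr (- \<alpha>) * ln (real n) powr (3 / 2))"
            by simp
          also have "\<dots> \<le> ?B"
            using assms by (intro mult_right_mono mult_left_mono real_sqrt_ge_one) auto
          finally show ?thesis .
        qed
      qed
      then show ?thesis
        using P.prob_space by (intro bexI[of _ "space (uniform_samples l)"]) auto
    qed
    then obtain G where G: "G \<in> sets (uniform_samples l)"
        "measure (uniform_samples l) G \<ge> 1 - real n powr (2 - c1)"
        "\<And>X h. X \<in> G \<Longrightarrow> mixed_holder (2 * c) \<alpha> h \<Longrightarrow> (\<And>i. i < l \<Longrightarrow> h (X i) = 0) \<Longrightarrow> L2_norm h \<le> ?B"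
      by blast
    obtain R where R: "\<And>f. mixed_holder c \<alpha> f \<Longrightarrow>
        {X \<in> space (uniform_samples l).
          square_integrable (\<lambda>p. f p - R X (sample_values l f X) p) \<and>
          L2_norm (\<lambda>p. f p - R X (sample_values l f X) p) \<le> ?B} = G"
      using optimal_recovery[OF assms(1) \<alpha> \<open>l > 0\<close> G(1), of ?B] G(3) by blast
    show ?thesis
      using G(2) by (intro exI[of _ R] allI impI) (simp only: R)
  qed
qed

end
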